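(* Let $(V,q)$ be an associative algebra and $M$ a $(V,q)$-bimodule ($V$, $M$ finite-dimensional graded, $|q|=0$), and let $(\tilde V,\tilde b,\tilde q)$ be the quadratic associative algebra obtained as double semidirect product of $V$ by $M$. Consider the map $c\mapsto\Omega_{\tilde C}$ associating to any multilinear mapping $c:V^k\to M$ of degree $2-k$ the cyclic form $\Omega_{\tilde C}$ on $\tilde V[1]$. Then this map is a complex morphism between the Hochschild cohomology for the $(V,q)$-bimodule $M$ and the Pinczon cohomology of cyclic forms $\mathcal C(\tilde V)$ on $\tilde V$, i.e. $$d_P\,\Omega_{\tilde C}=\{\Omega_{\tilde Q},\Omega_{\tilde C}\}=\Omega_{\widetilde{(d_Hc)[1]}} .$$
   Context: The ground field has characteristic $0$. $|x|$ is the degree in $V$, and $V[1]$ is $V$ with degree $\deg(x)=|x|-1$. All formulas use Koszul's sign rule: in any relation between homogeneous objects, the first term has sign $+$ and every other term is implicitly multiplied by the sign of the permutation of the odd letters (vectors, maps, forms) relating it to the first term. To a $k$-linear map $q:V^k\to W$ one associates the shifted map (capital letter, also denoted $q[1]$) $Q(x_1,\dots,x_k)=(-1)^{\sum_{j}(k-j)\deg x_j}q(x_1,\dots,x_k)$ on $V[1]$, of degree $|q|+k-1$. To a bilinear form $b$ one associates $B(x,y)=(-1)^{\deg x}b(x,y)$ on $V[1]$. Double semidirect product. $W=V\rtimes M$ is $V\times M$ with $q_W((x,a),(y,b))=(xy,\,x\cdot b+a\cdot y)$, where $xy=q(x,y)$. $W^\star=V^\star\times M^\star$ is a $W$-bimodule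 by $((x,a)\cdot f)(w)=f(w(x,a))$, $(f\cdot(x,a))(w)=f((x,a)w)$; for $f=(g,h)$ this is written $(x,a)\cdot(g,h)=(x\cdot g+a\cdot h,\,x\cdot h)$ and $(g,h)\cdot(x,a)=(g\cdot x+h\cdot a,\,h\cdot x)$. $\tilde V=W\times W^\star$ has the product $$\tilde q((x,a,g,h),(x',a',g',h'))=(xx',\,xa'+ax',\,x\cdot g'+g\cdot x'+a\cdot h'+h\cdot a',\,x\cdot h'+h\cdot x')$$ and the form $\tilde b((x,a,g,h),(x',a',g',h'))=g(x')+h(a')+g'(x)+h'(a)$. $\tilde Q,\tilde B$ are the shifted versions. The map. For $c:V^k\to M$ with shifted map $C$ (any homogeneous degree), $\tilde C:\tilde V[1]^k\to\tilde V[1]$ is $$\tilde C((x_1,a_1,g_1,h_1),\dots,(x_k,a_k,g_k,h_k))=\Big(0,\,C(x_1,\dots,x_k),\,\sum_jC_j(x_1,\dots,h_j,\dots,x_k),\,0\Big),$$ $C_j(x_1,\dots,h_j,\dots,x_k)=h_j(C(x_{j+1},\dots,x_k,\,\cdot\,,x_1,\dots,x_{j-1}))\in V^\star$. Forms and operators. For $F:\tilde V[1]^k\to\tilde V[1]$, $\Omega_F(v_1,\dots,v_{k+1})=\tilde B(F(v_1,\dots,v_k),v_{k+1})$. $\mathcal C(\tilde V)$ is the space of cyclic forms $\Omega$ on $\tilde V[1]$: $\Omega(v_{k+1},v_1,\dots,v_k)=\Omega(v_1,\dots,v_{k+1})$. The Pinczon bracket associated to $\tilde b$ is $\{\Omega,\Omega'\}=\sum_i\big(\iota_{e_i}\Omega\otimes\iota_{e'_i}\Omega'\big)^{Cycl}$,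 where $(e_i),(e_i')$ are homogeneous bases of $\tilde V$ with $\tilde b(e_i,e'_j)=\delta_{ij}$, $\iota$ is insertion in the first slot and $Cycl$ means sum over all cyclic permutations of the variables. $d_P=\{\Omega_{\tilde Q},\cdot\}$. $d_H$ is the Hochschild coboundary with values in $M$, written on shifted maps as $(d_Hc)[1]=[Q,C]=Q\circ C-C\circ Q$, i.e. $(d_Hc)[1](x_1,\dots,x_{k+1})=Q_W(C(x_1,\dots,x_k),x_{k+1})+Q_W(x_1,C(x_2,\dots,x_{k+1}))-\sum_{j=1}^kC(x_1,\dots,Q(x_j,x_{j+1}),\dots,x_{k+1})$ with Koszul signs, $Q_W$ being the shifted map of $q_W$. *)

theory Defs
  imports Complex_Main "HOL-Library.Function_Algebras" "HOL-Library.Product_Plus"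
begin

text \<open>
  A graded space is a type with a scalar multiplication \<open>s\<close> and a family \<open>G\<close> of homogeneous
  components indexed by the integers.  A \<open>k\<close>-linear map is a function on lists, of which only the
  values on lists of length \<open>k\<close> with entries in the space matter.
\<close>

definition decomposes :: "(int \<Rightarrow> 'a::comm_monoid_add set) \<Rightarrow> 'a \<Rightarrow> (int \<Rightarrow> 'a) \<Rightarrow> bool" where
  "decomposes G x c \<longleftrightarrow>
     (\<forall>d. c d \<in> G d) \<and> finite {d. c d \<noteq> 0} \<and> (\<Sum>d | c d \<noteq> 0. c d) = x"

definition fd_graded_space ::
    "('k::field \<Rightarrow> 'a::ab_group_add \<Rightarrow> 'a) \<Rightarrow> (int \<Rightarrow> 'a set) \<Rightarrow> bool" where
  "fd_graded_space s G \<longleftrightarrow>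
     vector_space s \<and> (\<exists>B. finite B \<and> module.span s B = UNIV) \<and>
     (\<forall>d. module.subspace s (G d)) \<and> (\<forall>x. \<exists>!c. decomposes G x c)"

definition hcomp :: "(int \<Rightarrow> 'a::comm_monoid_add set) \<Rightarrow> int \<Rightarrow> 'a \<Rightarrow> 'a" where
  "hcomp G d x = (THE c. decomposes G x c) d"

definition degs :: "(int \<Rightarrow> 'a::zero set) \<Rightarrow> int set" where
  "degs G = {d. G d \<noteq> {0}}"

definition ksg :: "int \<Rightarrow> 'a::ab_group_add \<Rightarrow> 'a" where
  "ksg n x = (if even n then x else - x)"

text \<open>
  Formulas with Koszul signs are given on homogeneous arguments.  \<open>kext G \<Phi>\<close> is the multilinear
  map whose value on homogeneous \<open>x\<^sub>1, \<dots>, x\<^sub>k\<close> of (unshifted) degrees \<open>d\<^sub>1, \<dots>, d\<^sub>k\<close> is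
  \<open>\<Phi> [d\<^sub>1, \<dots>, d\<^sub>k] [x\<^sub>1, \<dots>, x\<^sub>k]\<close>; every other argument is split into homogeneous components.
\<close>

definition kext :: "(int \<Rightarrow> 'a::comm_monoid_add set) \<Rightarrow> (int list \<Rightarrow> 'a list \<Rightarrow> 'b::comm_monoid_add)
    \<Rightarrow> 'a list \<Rightarrow> 'b" where
  "kext G \<Phi> xs =
     (\<Sum>ds | length ds = length xs \<and> set ds \<subseteq> degs G. \<Phi> ds (map2 (hcomp G) ds xs))"

text \<open>The total degree in the shifted space of letters of degrees \<open>ds\<close>.\<close>

definition sdeg :: "int list \<Rightarrow> int" where
  "sdeg ds = (\<Sum>d\<leftarrow>ds. d - 1)"

definition multilinear_on ::
    "('k \<Rightarrow> 'a::ab_group_add \<Rightarrow> 'a) \<Rightarrow> 'a set \<Rightarrow> ('k \<Rightarrow> 'b::ab_group_add \<Rightarrow> 'b) \<Rightarrow> nat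
      \<Rightarrow> ('a list \<Rightarrow> 'b) \<Rightarrow> bool" where
  "multilinear_on s U s' k F \<longleftrightarrow>
     (\<forall>xs i. length xs = k \<and> set xs \<subseteq> U \<and> i < k \<longrightarrow>
        (\<forall>x\<in>U. \<forall>y\<in>U. F (xs[i := x + y]) = F (xs[i := x]) + F (xs[i := y])) \<and>
        (\<forall>r. \<forall>x\<in>U. F (xs[i := s r x]) = s' r (F (xs[i := x]))))"

text \<open>
  The shifted map \<open>q[1]\<close> of a \<open>k\<close>-linear map; the list index \<open>j\<close> starts at \<open>0\<close>.
  The sign is an involution, so \<open>shift\<close> also turns a map on the shifted space into the
  map it comes from.
\<close>

definition shift :: "(int \<Rightarrow> 'a::comm_monoid_add set) \<Rightarrow> nat \<Rightarrow> ('a list \<Rightarrow> 'b::ab_group_add)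
    \<Rightarrow> 'a list \<Rightarrow> 'b" where
  "shift G k q = kext G (\<lambda>ds xs. ksg (\<Sum>j<k. (int k - 1 - int j) * (ds ! j - 1)) (q xs))"

definition graded_bilinear ::
    "('k::field \<Rightarrow> 'a::ab_group_add \<Rightarrow> 'a) \<Rightarrow> (int \<Rightarrow> 'a set) \<Rightarrow>
     ('k \<Rightarrow> 'b::ab_group_add \<Rightarrow> 'b) \<Rightarrow> (int \<Rightarrow> 'b set) \<Rightarrow>
     ('k \<Rightarrow> 'c::ab_group_add \<Rightarrow> 'c) \<Rightarrow> (int \<Rightarrow> 'c set) \<Rightarrow> ('a \<Rightarrow> 'b \<Rightarrow> 'c) \<Rightarrow> bool" where
  "graded_bilinear s1 G1 s2 G2 s3 G3 m \<longleftrightarrow>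
     (\<forall>x. Vector_Spaces.linear s2 s3 (m x)) \<and>
     (\<forall>y. Vector_Spaces.linear s1 s3 (\<lambda>x. m x y)) \<and>
     (\<forall>i j. \<forall>x\<in>G1 i. \<forall>y\<in>G2 j. m x y \<in> G3 (i + j))"

record ('k, 'v, 'm) gbimod =
  vscale :: "'k \<Rightarrow> 'v \<Rightarrow> 'v"
  vgr :: "int \<Rightarrow> 'v set"
  vmul :: "'v \<Rightarrow> 'v \<Rightarrow> 'v"
  mscale :: "'k \<Rightarrow> 'm \<Rightarrow> 'm"
  mgr :: "int \<Rightarrow> 'm set"
  lact :: "'v \<Rightarrow> 'm \<Rightarrow> 'm"
  ract :: "'m \<Rightarrow> 'v \<Rightarrow> 'm"

definition graded_bimodule ::
    "('k::field, 'v::ab_group_add, 'm::ab_group_add) gbimod \<Rightarrow> bool" where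
  "graded_bimodule A \<longleftrightarrow>
     fd_graded_space (vscale A) (vgr A) \<and> fd_graded_space (mscale A) (mgr A) \<and>
     graded_bilinear (vscale A) (vgr A) (vscale A) (vgr A) (vscale A) (vgr A) (vmul A) \<and>
     graded_bilinear (vscale A) (vgr A) (mscale A) (mgr A) (mscale A) (mgr A) (lact A) \<and>
     graded_bilinear (mscale A) (mgr A) (vscale A) (vgr A) (mscale A) (mgr A) (ract A) \<and>
     (\<forall>x y z. vmul A (vmul A x y) z = vmul A x (vmul A y z)) \<and>
     (\<forall>x y a. lact A (vmul A x y) a = lact A x (lact A y a)) \<and>
     (\<forall>x a y. ract A (lact A x a) y = lact A x (ract A a y)) \<and>
     (\<forall>a x y. ract A (ract A a x) y = ract A a (vmul A x y))"

definition cochains ::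
    "('k::field, 'v::ab_group_add, 'm::ab_group_add) gbimod \<Rightarrow> nat \<Rightarrow> int \<Rightarrow> ('v list \<Rightarrow> 'm) set" where
  "cochains A k p =
     {c. multilinear_on (vscale A) UNIV (mscale A) k c \<and>
         (\<forall>ds xs. length ds = k \<and> length xs = k \<and> (\<forall>i<k. xs ! i \<in> vgr A (ds ! i)) \<longrightarrow>
            c xs \<in> mgr A (sum_list ds + p))}"

definition wgr :: "('k, 'v, 'm) gbimod \<Rightarrow> int \<Rightarrow> ('v \<times> 'm) set" where
  "wgr A d = vgr A d \<times> mgr A d"

definition wmul :: "('k, 'v, 'm::ab_group_add) gbimod \<Rightarrow> 'v \<times> 'm \<Rightarrow> 'v \<times> 'm \<Rightarrow> 'v \<times> 'm" where
  "wmul A = (\<lambda>(x, a) (y, b). (vmul A x y, lact A x b + ract A a y))"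

text \<open>
  \<open>hoch_shifted A k w C\<close> is \<open>[Q, C]\<close> for a \<open>k\<close>-linear \<open>C\<close> of shifted degree \<open>w\<close>.  Letters are
  read in the order \<open>Q, C, x\<^sub>1, \<dots>, x\<^sub>k\<^sub>+\<^sub>1\<close>, and \<open>Q\<close> has degree \<open>1\<close>.
\<close>

definition hoch_shifted :: "('k, 'v::ab_group_add, 'm::ab_group_add) gbimod \<Rightarrow> nat \<Rightarrow> int \<Rightarrow>
    ('v list \<Rightarrow> 'm) \<Rightarrow> 'v list \<Rightarrow> 'm" where
  "hoch_shifted A k w C =
     (let Q = shift (vgr A) 2 (\<lambda>xs. vmul A (xs ! 0) (xs ! 1));
          QW = shift (wgr A) 2 (\<lambda>ws. wmul A (ws ! 0) (ws ! 1))
      in kext (vgr A) (\<lambda>ds xs.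
           snd (QW [(0, C (take k xs)), (xs ! k, 0)])
           + ksg (w * sdeg (take 1 ds)) (snd (QW [(xs ! 0, 0), (0, C (drop 1 xs))]))
           - (\<Sum>j<k. ksg (w + sdeg (take j ds))
                (C (take j xs @ [Q [xs ! j, xs ! Suc j]] @ drop (j + 2) xs)))))"

text \<open>\<open>d\<^sub>H\<close> on \<open>k\<close>-linear maps of degree \<open>p\<close>, determined by \<open>(d\<^sub>H c)[1] = [Q, C]\<close>.\<close>

definition hochschild_d :: "('k, 'v::ab_group_add, 'm::ab_group_add) gbimod \<Rightarrow> nat \<Rightarrow> int \<Rightarrow>
    ('v list \<Rightarrow> 'm) \<Rightarrow> 'v list \<Rightarrow> 'm" where
  "hochschild_d A k p c =
     shift (vgr A) (Suc k) (hoch_shifted A k (p + int k - 1) (shift (vgr A) k c))"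

definition dual_gr :: "('k::field \<Rightarrow> 'a::ab_group_add \<Rightarrow> 'a) \<Rightarrow> (int \<Rightarrow> 'a set) \<Rightarrow> int
    \<Rightarrow> ('a \<Rightarrow> 'k) set" where
  "dual_gr s G d =
     {f. Vector_Spaces.linear s (*) f \<and> (\<forall>i. i \<noteq> - d \<longrightarrow> (\<forall>x\<in>G i. f x = 0))}"

type_synonym ('k, 'v, 'm) tilde = "'v \<times> 'm \<times> ('v \<Rightarrow> 'k) \<times> ('m \<Rightarrow> 'k)"

definition tcarrier ::
    "('k::field, 'v::ab_group_add, 'm::ab_group_add) gbimod \<Rightarrow> ('k, 'v, 'm) tilde set" where
  "tcarrier A = UNIV \<times> UNIV \<times> {g. Vector_Spaces.linear (vscale A) (*) g}
                  \<times> {h. Vector_Spaces.linear (mscale A) (*) h}"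

definition tscale :: "('k::field, 'v::ab_group_add, 'm::ab_group_add) gbimod \<Rightarrow> 'k \<Rightarrow>
    ('k, 'v, 'm) tilde \<Rightarrow> ('k, 'v, 'm) tilde" where
  "tscale A r = (\<lambda>(x, a, g, h). (vscale A r x, mscale A r a, (\<lambda>y. r * g y), (\<lambda>b. r * h b)))"

definition tgr :: "('k::field, 'v::ab_group_add, 'm::ab_group_add) gbimod \<Rightarrow> int \<Rightarrow>
    ('k, 'v, 'm) tilde set" where
  "tgr A d = vgr A d \<times> mgr A d \<times> dual_gr (vscale A) (vgr A) d \<times> dual_gr (mscale A) (mgr A) d"

text \<open>
  The bimodule structure on the dual of \<open>V \<times> M\<close>, one component at a time, for a bilinear map
  \<open>m\<close> which is one of the products \<open>V \<times> V \<rightarrow> V\<close>, \<open>V \<times> M \<rightarrow> M\<close>, \<open>M \<times> V \<rightarrow> M\<close>.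
  For \<open>x\<close> of degree \<open>d\<close> and \<open>f\<close> of degree \<open>e\<close>,
  \<open>(x \<cdot> f) (y) = (-1)\<^bsup>d (e + |y|)\<^esup> f (y x)\<close> and \<open>(f \<cdot> x) (y) = f (x y)\<close>.
\<close>

definition dual_lact :: "(int \<Rightarrow> 'y::comm_monoid_add set) \<Rightarrow> ('y \<Rightarrow> 'x \<Rightarrow> 'z) \<Rightarrow> int \<Rightarrow> int \<Rightarrow>
    'x \<Rightarrow> ('z \<Rightarrow> 'k::field) \<Rightarrow> 'y \<Rightarrow> 'k" where
  "dual_lact G m d e x f = (\<lambda>y. \<Sum>i\<in>degs G. ksg (d * (e + i)) (f (m (hcomp G i y) x)))"

definition dual_ract :: "('x \<Rightarrow> 'y \<Rightarrow> 'z) \<Rightarrow> ('z \<Rightarrow> 'k) \<Rightarrow> 'x \<Rightarrow> 'y \<Rightarrow> 'k" where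
  "dual_ract m f x = (\<lambda>y. f (m x y))"

definition tmul :: "('k::field, 'v::ab_group_add, 'm::ab_group_add) gbimod \<Rightarrow>
    ('k, 'v, 'm) tilde list \<Rightarrow> ('k, 'v, 'm) tilde" where
  "tmul A = kext (tgr A) (\<lambda>ds vs.
     let (x, a, g, h) = vs ! 0; (x', a', g', h') = vs ! 1; d = ds ! 0; d' = ds ! 1
     in (vmul A x x',
         lact A x a' + ract A a x',
         dual_lact (vgr A) (vmul A) d d' x g' + dual_ract (vmul A) g x'
           + dual_lact (vgr A) (lact A) d d' a h' + dual_ract (ract A) h a',
         dual_lact (mgr A) (ract A) d d' x h' + dual_ract (lact A) h x'))"

definition tform :: "('k::field, 'v::ab_group_add, 'm::ab_group_add) gbimod \<Rightarrow>
    ('k, 'v, 'm) tilde list \<Rightarrow> 'k" where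
  "tform A = kext (tgr A) (\<lambda>ds vs.
     let (x, a, g, h) = vs ! 0; (x', a', g', h') = vs ! 1
     in g x' + h a' + ksg (ds ! 0 * ds ! 1) (g' x + h' a))"

definition tQ :: "('k::field, 'v::ab_group_add, 'm::ab_group_add) gbimod \<Rightarrow>
    ('k, 'v, 'm) tilde list \<Rightarrow> ('k, 'v, 'm) tilde" where
  "tQ A = shift (tgr A) 2 (tmul A)"

text \<open>The general shift for \<open>k = 2\<close> is the sign \<open>(-1)\<^bsup>deg x\<^esup>\<close> that defines \<open>B\<close>.\<close>

definition tB :: "('k::field, 'v::ab_group_add, 'm::ab_group_add) gbimod \<Rightarrow>
    ('k, 'v, 'm) tilde list \<Rightarrow> 'k" where
  "tB A = shift (tgr A) 2 (tform A)"

text \<open>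
  \<open>insert_dual A C ds vs j\<close> is
  \<open>C\<^sub>j (x\<^sub>1, \<dots>, h\<^sub>j, \<dots>, x\<^sub>k) = \<plusminus> h\<^sub>j (C (x\<^sub>j\<^sub>+\<^sub>1, \<dots>, x\<^sub>k, \<cdot>, x\<^sub>1, \<dots>, x\<^sub>j\<^sub>-\<^sub>1))\<close>
  (with \<open>j\<close> counted from \<open>0\<close>) on homogeneous \<open>vs\<close> of degrees \<open>ds\<close>.
  On the shifted space the pairing of a dual vector with a vector is \<open>B\<close>, so the Koszul sign is
  that of
  \<open>B (C\<^sub>j (x\<^sub>1, \<dots>, h\<^sub>j, \<dots>, x\<^sub>k), y) = \<plusminus> B (C (x\<^sub>j\<^sub>+\<^sub>1, \<dots>, x\<^sub>k, y, x\<^sub>1, \<dots>, x\<^sub>j\<^sub>-\<^sub>1), h\<^sub>j)\<close>,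
  which moves \<open>x\<^sub>1, \<dots>, x\<^sub>j\<^sub>-\<^sub>1, h\<^sub>j\<close> past \<open>x\<^sub>j\<^sub>+\<^sub>1, \<dots>, x\<^sub>k, y\<close>.  Since
  \<open>B (g, y) = (-1)\<^bsup>deg y\<^esup> g (y)\<close> and \<open>B (a, h) = - h (a)\<close>, removing \<open>B\<close> adds \<open>(-1)\<^bsup>|y|\<^esup>\<close>.
  This is the only choice of sign for which the form of the extended map is cyclic.
\<close>

definition insert_dual :: "('k::field, 'v::ab_group_add, 'm::ab_group_add) gbimod \<Rightarrow>
    ('v list \<Rightarrow> 'm) \<Rightarrow> int list \<Rightarrow> ('k, 'v, 'm) tilde list \<Rightarrow> nat \<Rightarrow> 'v \<Rightarrow> 'k" where
  "insert_dual A C ds vs j =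
     (let h = snd (snd (snd (vs ! j)))
      in (\<lambda>y. \<Sum>i\<in>degs (vgr A).
            ksg (i + sdeg (take (Suc j) ds) * sdeg (drop (Suc j) ds @ [i]))
              (h (C (map fst (drop (Suc j) vs) @ [hcomp (vgr A) i y] @ map fst (take j vs))))))"

definition tilde_map :: "('k::field, 'v::ab_group_add, 'm::ab_group_add) gbimod \<Rightarrow> nat \<Rightarrow>
    ('v list \<Rightarrow> 'm) \<Rightarrow> ('k, 'v, 'm) tilde list \<Rightarrow> ('k, 'v, 'm) tilde" where
  "tilde_map A k C = kext (tgr A) (\<lambda>ds vs.
     (0, C (map fst vs), (\<lambda>y. \<Sum>j<k. insert_dual A C ds vs j y), 0))"

definition Omega :: "('k::field, 'v::ab_group_add, 'm::ab_group_add) gbimod \<Rightarrow>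
    (('k, 'v, 'm) tilde list \<Rightarrow> ('k, 'v, 'm) tilde) \<Rightarrow> ('k, 'v, 'm) tilde list \<Rightarrow> 'k" where
  "Omega A F vs = tB A [F (butlast vs), last vs]"

definition cyclic_forms :: "('k::field, 'v::ab_group_add, 'm::ab_group_add) gbimod \<Rightarrow> nat \<Rightarrow>
    (('k, 'v, 'm) tilde list \<Rightarrow> 'k) set" where
  "cyclic_forms A n =
     {\<Omega>. multilinear_on (tscale A) (tcarrier A) (*) n \<Omega> \<and>
         (\<forall>ds vs. length ds = n \<and> length vs = n \<and> 0 < n \<and> (\<forall>i<n. vs ! i \<in> tgr A (ds ! i)) \<longrightarrow>
            \<Omega> (last vs # butlast vs) = ksg (sdeg [last ds] * sdeg (butlast ds)) (\<Omega> vs))}"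

text \<open>Sum over all cyclic permutations of the \<open>n\<close> variables, with Koszul signs.\<close>

definition cycl :: "('k::field, 'v::ab_group_add, 'm::ab_group_add) gbimod \<Rightarrow> nat \<Rightarrow>
    (('k, 'v, 'm) tilde list \<Rightarrow> 'k) \<Rightarrow> ('k, 'v, 'm) tilde list \<Rightarrow> 'k" where
  "cycl A n \<Psi> = kext (tgr A) (\<lambda>ds vs.
     \<Sum>r<n. ksg (sdeg (take r ds) * sdeg (drop r ds)) (\<Psi> (drop r vs @ take r vs)))"

definition homogeneous_basis :: "('k::field, 'v::ab_group_add, 'm::ab_group_add) gbimod \<Rightarrow> nat \<Rightarrow>
    (nat \<Rightarrow> ('k, 'v, 'm) tilde) \<Rightarrow> bool" where
  "homogeneous_basis A N e \<longleftrightarrow>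
     inj_on e {..<N} \<and> (\<forall>i<N. \<exists>d. e i \<in> tgr A d) \<and>
     \<not> module.dependent (tscale A) (e ` {..<N}) \<and>
     module.span (tscale A) (e ` {..<N}) = tcarrier A"

definition dual_bases :: "('k::field, 'v::ab_group_add, 'm::ab_group_add) gbimod \<Rightarrow> nat \<Rightarrow>
    (nat \<Rightarrow> ('k, 'v, 'm) tilde) \<Rightarrow> (nat \<Rightarrow> ('k, 'v, 'm) tilde) \<Rightarrow> bool" where
  "dual_bases A N e e' \<longleftrightarrow>
     homogeneous_basis A N e \<and> homogeneous_basis A N e' \<and>
     (\<forall>i<N. \<forall>j<N. tform A [e i, e' j] = (if i = j then 1 else 0))"

text \<open>
  The bracket of a form \<open>\<Omega>\<close> in \<open>n\<close> variables with a form \<open>\<Omega>'\<close> of degree \<open>w'\<close> in \<open>n'\<close> variables.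
  The Koszul sign is that of the passage from \<open>\<Omega>, \<Omega>', e\<^sub>i, e'\<^sub>i, v\<^sub>1, v\<^sub>2, \<dots>\<close> to
  \<open>\<Omega>, e\<^sub>i, v\<^sub>1, \<dots>, v\<^sub>n\<^sub>-\<^sub>1, \<Omega>', e'\<^sub>i, v\<^sub>n, \<dots>\<close>; the place of the pair \<open>e\<^sub>i, e'\<^sub>i\<close> in the first word is
  irrelevant because \<open>deg e\<^sub>i + deg e'\<^sub>i\<close> is even.
\<close>

definition pinczon :: "('k::field, 'v::ab_group_add, 'm::ab_group_add) gbimod \<Rightarrow> nat \<Rightarrow>
    (nat \<Rightarrow> ('k, 'v, 'm) tilde) \<Rightarrow> (nat \<Rightarrow> ('k, 'v, 'm) tilde) \<Rightarrow>
    nat \<Rightarrow> (('k, 'v, 'm) tilde list \<Rightarrow> 'k) \<Rightarrow>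
    nat \<Rightarrow> int \<Rightarrow> (('k, 'v, 'm) tilde list \<Rightarrow> 'k) \<Rightarrow> ('k, 'v, 'm) tilde list \<Rightarrow> 'k" where
  "pinczon A N e e' n \<Omega> n' w' \<Omega>' =
     cycl A (n + n' - 2) (\<lambda>vs. \<Sum>i<N. kext (tgr A)
       (\<lambda>ds us.
          let \<epsilon> = sdeg [ds ! 0]; \<epsilon>' = sdeg [ds ! 1]; P = sdeg (take (n - 1) (drop 2 ds))
          in ksg (w' * (\<epsilon> + P) + \<epsilon>' * P)
               (\<Omega> (us ! 0 # take (n - 1) (drop 2 us)) * \<Omega>' (us ! 1 # drop (n - 1) (drop 2 us))))
       (e i # e' i # vs))"

definition pinczon_d :: "('k::field, 'v::ab_group_add, 'm::ab_group_add) gbimod \<Rightarrow> nat \<Rightarrow>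
    (nat \<Rightarrow> ('k, 'v, 'm) tilde) \<Rightarrow> (nat \<Rightarrow> ('k, 'v, 'm) tilde) \<Rightarrow>
    nat \<Rightarrow> int \<Rightarrow> (('k, 'v, 'm) tilde list \<Rightarrow> 'k) \<Rightarrow> ('k, 'v, 'm) tilde list \<Rightarrow> 'k" where
  "pinczon_d A N e e' n w \<Omega> = pinczon A N e e' 3 (Omega A (tQ A)) n w \<Omega>"

text \<open>
  The map \<open>c \<mapsto> \<Omega>\<^sub>C\<^sub>~\<close>.  If \<open>C\<close> has shifted degree \<open>w\<close>, the form has degree \<open>w + 2\<close>, since \<open>B\<close> has
  degree \<open>2\<close> on the shifted space.
\<close>

definition Omega_of :: "('k::field, 'v::ab_group_add, 'm::ab_group_add) gbimod \<Rightarrow> nat \<Rightarrow>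
    ('v list \<Rightarrow> 'm) \<Rightarrow> ('k, 'v, 'm) tilde list \<Rightarrow> 'k" where
  "Omega_of A k c = Omega A (tilde_map A k (shift (vgr A) k c))"

end

theory Submission
  imports Defs
begin

text \<open>
  Everything is multilinear, so it suffices to compare values on homogeneous arguments.  There
  \<open>\<Omega>\<^bsub>C~\<^esub>\<close> is the cyclic sum of the single term \<open>B (C (x\<^sub>1, \<dots>, x\<^sub>k), h\<^sub>k\<^sub>+\<^sub>1)\<close>, and it
  vanishes unless the degrees of its arguments add up to a fixed number; for \<open>C\<close> of odd shifted
  degree this makes all Koszul signs of its rotations trivial.
  Invariance of \<open>b~\<close> under \<open>q~\<close> and the expansion in dual bases turn \<open>{\<Omega>\<^bsub>Q~\<^esub>, \<Omega>}\<close> into the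
  cyclic sum of \<open>\<Omega> (Q~ (v\<^sub>1, v\<^sub>2), v\<^sub>3, \<dots>)\<close>.  For \<open>\<Omega> = \<Omega>\<^bsub>C~\<^esub>\<close> this is a double sum of terms in
  which \<open>Q~\<close> sits at some place of \<open>B (C (\<dots>), \<cdot>)\<close>.  The places inside \<open>C\<close> give the terms
  \<open>C (\<dots>, Q (x\<^sub>j, x\<^sub>j\<^sub>+\<^sub>1), \<dots>)\<close> of \<open>[Q, C]\<close>; the last place contributes the two halves
  \<open>x \<cdot> h\<close> and \<open>h \<cdot> x\<close> of the product, one of which has to be rotated by one step; these are the terms
  with the right and the left action on \<open>M\<close>.
\<close>

section \<open>Signs and sums over lists\<close>

text \<open>Koszul signs depend on degrees, and 0 has every degree, so a signed formula is not a
  function of the letters alone. Formulas therefore carry the list of degrees, and extending them to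
  all arguments requires that they vanish as soon as one letter is 0. The comparison rests on two
  parities. A cochain of degree 2 - k has shifted degree 1, and only words whose unshifted degrees
  add up to k - 2 contribute. On the k + 1 letters of the form of C~ the total shifted degree is
  then -3: complementary arcs of the cyclic word have opposite parities, their product is even, and
  no sign remains. On the k + 2 letters of the bracket the total is -4: complementary arcs have
  equal parities, so the sign of a rotation does not disappear but is the parity of the prefix that
  is moved. The parity of prefix sums is periodic along the cyclic word, so every signed summand is
  a periodic function of its cyclic place. Equality then amounts to a relabelling of pairs
  consisting of the cyclic place where \<open>tQ\<close> acts and the position of its value in the
  word.\<close>

lemma ksg_0 [simp]: "ksg n 0 = 0"
  by (simp add: ksg_def)

lemma ksg_zero_exp [simp]: "ksg 0 x = x"
  by (simp add: ksg_def)

lemma ksg_add: "ksg n (x + y) = ksg n x + ksg n y"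
  by (simp add: ksg_def)

lemma ksg_diff: "ksg n (x - y) = ksg n x - ksg n y"
  by (simp add: ksg_def)

lemma ksg_minus: "ksg n (- x) = - ksg n x"
  by (simp add: ksg_def)

lemma ksg_ksg [simp]: "ksg m (ksg n x) = ksg (m + n) x"
  by (simp add: ksg_def)

lemma ksg_sum: "ksg n (sum f S) = (\<Sum>i\<in>S. ksg n (f i))"
  by (simp add: ksg_def sum_negf)

lemma ksg_cong: "even (m + n) \<Longrightarrow> ksg m x = ksg n x"
  by (auto simp: ksg_def)

lemma ksg_minus_cong: "odd (m + n) \<Longrightarrow> ksg m x = - ksg n x"
  by (auto simp: ksg_def)

lemma ksg_mult_right: "x * ksg n y = ksg n (x * y :: 'a::comm_ring)"
  by (simp add: ksg_def)

lemma ksg_eq_0_iff [simp]: "ksg n x = 0 \<longleftrightarrow> x = 0"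
  by (simp add: ksg_def)

lemma fst_ksg [simp]: "fst (ksg n x) = ksg n (fst x)"
  and snd_ksg [simp]: "snd (ksg n x) = ksg n (snd x)"
  by (simp_all add: ksg_def)

lemma ksg_fun: "ksg n f x = ksg n (f x)"
  by (simp add: ksg_def)

section \<open>Sums indexed by lists of degrees\<close>

lemma lists_Suc:
  "{ds. length ds = Suc n \<and> set ds \<subseteq> D}
    = (\<lambda>(ds, d). d # ds) ` ({ds. length ds = n \<and> set ds \<subseteq> D} \<times> D)"
  by (auto simp: image_iff length_Suc_conv)

lemma lists_snoc:
  "{ds. length ds = Suc n \<and> set ds \<subseteq> D}
    = (\<lambda>(ds, d). ds @ [d]) ` ({ds. length ds = n \<and> set ds \<subseteq> D} \<times> D)"
  by (auto simp: image_iff length_Suc_conv_rev)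

lemma sum_lists_Suc:
  "(\<Sum>ds | length ds = Suc n \<and> set ds \<subseteq> D. f ds)
    = (\<Sum>d\<in>D. \<Sum>ds | length ds = n \<and> set ds \<subseteq> D. f (d # ds))"
  unfolding lists_Suc
  by (subst sum.reindex, force simp: inj_on_def, subst sum.swap)
    (simp add: sum.cartesian_product split_def)

lemma sum_lists_snoc:
  "(\<Sum>ds | length ds = Suc n \<and> set ds \<subseteq> D. f ds)
    = (\<Sum>ds | length ds = n \<and> set ds \<subseteq> D. \<Sum>d\<in>D. f (ds @ [d]))"
  unfolding lists_snoc
  by (subst sum.reindex, force simp: inj_on_def) (simp add: sum.cartesian_product split_def)

text \<open>Replaces reindexing over the integers modulo n: cyclic sums are written as sums over r <
  n of periodic functions on the naturals. A shift by one loses the first value and gains the one a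
  period later.\<close>

lemma sum_periodic_shift:
  fixes f :: "nat \<Rightarrow> 'a::ab_group_add"
  assumes "\<And>r. f (r + n) = f r"
  shows "(\<Sum>r<n. f (r + j)) = (\<Sum>r<n. f r)"
proof (induction j)
  case (Suc j)
  have "(\<Sum>r<n. f (r + Suc j)) + f j = (\<Sum>r<Suc n. f (r + j))"
    by (subst sum.lessThan_Suc_shift) (simp add: add.commute)
  also have "\<dots> = (\<Sum>r<n. f (r + j)) + f j"
    using assms[of j] by (simp add: add.commute)
  finally show ?case using Suc by simp
qed simp

section \<open>Linearity in one slot\<close>

text \<open>Linearity relative to a subset of the source. The functionals in
  \<open>tcarrier A\<close> need not exhaust their function type, and a formula with Koszul signs is
  linear only on one homogeneous piece at a time.\<close>

definition lin_on :: "('k \<Rightarrow> 'a::ab_group_add \<Rightarrow> 'a) \<Rightarrow> 'a set \<Rightarrow> ('k \<Rightarrow> 'b::ab_group_add \<Rightarrow> 'b)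
    \<Rightarrow> ('a \<Rightarrow> 'b) \<Rightarrow> bool" where
  "lin_on s S s' f \<longleftrightarrow>
     (\<forall>x\<in>S. \<forall>y\<in>S. f (x + y) = f x + f y) \<and> (\<forall>r. \<forall>x\<in>S. f (s r x) = s' r (f x))"

lemma lin_on_mono: "lin_on s S s' f \<Longrightarrow> S' \<subseteq> S \<Longrightarrow> lin_on s S' s' f"
  unfolding lin_on_def by blast

lemma lin_on_cong: "(\<And>x. x \<in> S \<Longrightarrow> f x = g x) \<Longrightarrow> lin_on s S s' g
    \<Longrightarrow> (\<And>x y. x \<in> S \<Longrightarrow> y \<in> S \<Longrightarrow> x + y \<in> S) \<Longrightarrow> (\<And>r x. x \<in> S \<Longrightarrow> s r x \<in> S)
    \<Longrightarrow> lin_on s S s' f"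
  by (auto simp: lin_on_def)

context vector_space
begin

lemma scale_ksg: "scale r (ksg n x) = ksg n (scale r x)"
  by (simp add: ksg_def)

lemma lin_on_add: "lin_on s S scale f \<Longrightarrow> lin_on s S scale g \<Longrightarrow> lin_on s S scale (\<lambda>x. f x + g x)"
  by (simp add: lin_on_def scale_right_distrib add_ac)

lemma lin_on_uminus: "lin_on s S scale f \<Longrightarrow> lin_on s S scale (\<lambda>x. - f x)"
  by (simp add: lin_on_def)

lemma lin_on_diff: "lin_on s S scale f \<Longrightarrow> lin_on s S scale g \<Longrightarrow> lin_on s S scale (\<lambda>x. f x - g x)"
  by (simp add: lin_on_def scale_right_diff_distrib algebra_simps)

lemma lin_on_ksg: "lin_on s S scale f \<Longrightarrow> lin_on s S scale (\<lambda>x. ksg n (f x))"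
  by (simp add: lin_on_def scale_ksg ksg_add)

lemma lin_on_sum: "(\<And>i. i \<in> I \<Longrightarrow> lin_on s S scale (f i)) \<Longrightarrow> lin_on s S scale (\<lambda>x. \<Sum>i\<in>I. f i x)"
  by (simp add: lin_on_def scale_sum_right sum.distrib)

lemma lin_on_scale: "lin_on s S scale f \<Longrightarrow> lin_on s S scale (\<lambda>x. scale r (f x))"
  by (simp add: lin_on_def scale_right_distrib mult.commute)

end

lemma linear_ksg: "Vector_Spaces.linear s s' f \<Longrightarrow> f (ksg n x) = ksg n (f x)"
  by (simp add: ksg_def linear_iff_module_hom module_hom.neg)

lemma linear_zero: "Vector_Spaces.linear s s' f \<Longrightarrow> f 0 = 0"
  by (simp add: linear_iff_module_hom module_hom.zero)

lemma linear_sum': "Vector_Spaces.linear s s' f \<Longrightarrow> f (sum g I) = (\<Sum>i\<in>I. f (g i))"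
  by (simp add: linear_iff_module_hom module_hom.sum)

lemma linear_plus: "Vector_Spaces.linear s s' f \<Longrightarrow> f (x + y) = f x + f y"
  by (simp add: Vector_Spaces.linear_iff)

lemma linear_scale': "Vector_Spaces.linear s s' f \<Longrightarrow> f (s r x) = s' r (f x)"
  by (simp add: Vector_Spaces.linear_iff)

lemma lin_on_comp:
  "Vector_Spaces.linear s' s'' g \<Longrightarrow> lin_on s S s' f \<Longrightarrow> lin_on s S s'' (\<lambda>x. g (f x))"
  by (simp add: lin_on_def Vector_Spaces.linear_iff)

section \<open>Multilinear maps on lists, one slot at a time\<close>

lemma multilinear_on_iff:
  "multilinear_on s U s' n F \<longleftrightarrow>
     (\<forall>xs i. length xs = n \<and> set xs \<subseteq> U \<and> i < n \<longrightarrow> lin_on s U s' (\<lambda>x. F (xs[i := x])))"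
  unfolding multilinear_on_def lin_on_def by blast

lemma multilinear_onD:
  "multilinear_on s U s' n F \<Longrightarrow> length xs = n \<Longrightarrow> set xs \<subseteq> U \<Longrightarrow> i < n
    \<Longrightarrow> lin_on s U s' (\<lambda>x. F (xs[i := x]))"
  unfolding multilinear_on_iff by blast

lemma multilinear_on_slot:
  assumes "multilinear_on s U s' n F" "set us \<subseteq> U" "set vs \<subseteq> U" "0 \<in> U"
    "n = length us + Suc (length vs)"
  shows "lin_on s U s' (\<lambda>x. F (us @ x # vs))"
  using multilinear_onD[OF assms(1), of "us @ 0 # vs" "length us"] assms(2-) by simp

lemma rotate1_update:
  "i < length xs \<Longrightarrow> rotate1 (xs[i := x])
    = (rotate1 xs)[(if i = 0 then length xs - 1 else i - 1) := x]"
  by (cases xs; cases i) (auto simp: list_update_append)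

lemma multilinear_on_rotate:
  fixes F :: "'a::ab_group_add list \<Rightarrow> 'b::ab_group_add"
  assumes "multilinear_on s U s' n F"
  shows "multilinear_on s U s' n (\<lambda>xs. F (rotate r xs))"
proof (induction r)
  case 0
  show ?case using assms by simp
next
  case (Suc r)
  show ?case unfolding multilinear_on_iff
  proof (intro allI impI, elim conjE)
    fix xs :: "'a list" and i assume *: "length xs = n" "set xs \<subseteq> U" "i < n"
    have "lin_on s U s' (\<lambda>x. F (rotate r ((rotate1 xs)[(if i = 0 then length xs - 1 else i - 1) := x])))"
      by (rule multilinear_onD[OF Suc]) (use * in auto)
    then show "lin_on s U s' (\<lambda>x. F (rotate (Suc r) (xs[i := x])))"
      using * rotate1_update[of i xs] by (simp add: rotate1_rotate_swap)
  qed
qed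

section \<open>Graded spaces\<close>

abbreviation homog :: "(int \<Rightarrow> 'a set) \<Rightarrow> int list \<Rightarrow> 'a list \<Rightarrow> bool" where
  "homog G \<equiv> list_all2 (\<lambda>d x. x \<in> G d)"

text \<open>A graded subspace \<open>U\<close> of an ambient vector space: the double semidirect product contains
  linear functionals only, which do not exhaust the function type.\<close>

locale graded = vector_space s for s :: "'k::field \<Rightarrow> 'a::ab_group_add \<Rightarrow> 'a" +
  fixes U :: "'a set" and G :: "int \<Rightarrow> 'a set"
  assumes subspace_U: "subspace U"
    and subspace_G: "subspace (G d)"
    and G_subset: "G d \<subseteq> U"
    and decomp: "x \<in> U \<Longrightarrow> \<exists>!c. decomposes G x c"
begin

lemma zero_U: "0 \<in> U" using subspace_U by (rule subspace_0)
lemma zero_G: "0 \<in> G d" using subspace_G by (rule subspace_0)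
lemma add_G: "x \<in> G d \<Longrightarrow> y \<in> G d \<Longrightarrow> x + y \<in> G d" using subspace_G by (rule subspace_add)
lemma add_U: "x \<in> U \<Longrightarrow> y \<in> U \<Longrightarrow> x + y \<in> U" using subspace_U by (rule subspace_add)
lemma scale_G: "x \<in> G d \<Longrightarrow> s r x \<in> G d" using subspace_G by (rule subspace_scale)
lemma scale_U: "x \<in> U \<Longrightarrow> s r x \<in> U" using subspace_U by (rule subspace_scale)
lemma ksg_G: "x \<in> G d \<Longrightarrow> ksg n x \<in> G d" using subspace_neg[OF subspace_G] by (simp add: ksg_def)
lemma sum_G: "(\<And>i. i \<in> I \<Longrightarrow> f i \<in> G d) \<Longrightarrow> sum f I \<in> G d" using subspace_G by (rule subspace_sum)
lemma sum_U: "(\<And>i. i \<in> I \<Longrightarrow> f i \<in> U) \<Longrightarrow> sum f I \<in> U" using subspace_U by (rule subspace_sum)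
lemma G_U: "x \<in> G d \<Longrightarrow> x \<in> U" using G_subset by blast

lemma hcomp_eq: "decomposes G x c \<Longrightarrow> x \<in> U \<Longrightarrow> hcomp G d x = c d"
  using the1_equality[OF decomp] unfolding hcomp_def by metis

lemma decomposes_hcomp: "x \<in> U \<Longrightarrow> decomposes G x (\<lambda>d. hcomp G d x)"
  using theI'[OF decomp] unfolding hcomp_def by simp

lemma hcomp_in: "x \<in> U \<Longrightarrow> hcomp G d x \<in> G d"
  using decomposes_hcomp unfolding decomposes_def by blast

lemma hcomp_U: "x \<in> U \<Longrightarrow> hcomp G d x \<in> U"
  using hcomp_in G_U by blast

lemma finite_hcomp: "x \<in> U \<Longrightarrow> finite {d. hcomp G d x \<noteq> 0}"
  using decomposes_hcomp unfolding decomposes_def by blast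

lemma hcomp_homog: "x \<in> G d \<Longrightarrow> hcomp G d' x = (if d' = d then x else 0)"
proof -
  assume x: "x \<in> G d"
  have "{d'. (if d' = d then x else 0) \<noteq> 0} = (if x = 0 then {} else {d})"
    by auto
  then have "decomposes G x (\<lambda>d'. if d' = d then x else 0)"
    using x by (auto simp: decomposes_def zero_G)
  then show ?thesis using hcomp_eq G_U[OF x] by blast
qed

lemma sum_decomposes:
  "decomposes G x c \<Longrightarrow> finite D \<Longrightarrow> {d. c d \<noteq> 0} \<subseteq> D \<Longrightarrow> (\<Sum>d\<in>D. c d) = x"
  unfolding decomposes_def by (metis (mono_tags, lifting) DiffD2 mem_Collect_eq sum.mono_neutral_left)

lemma decomposesI:
  "(\<And>d. c d \<in> G d) \<Longrightarrow> finite D \<Longrightarrow> (\<And>d. d \<notin> D \<Longrightarrow> c d = 0) \<Longrightarrow> (\<Sum>d\<in>D. c d) = x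
    \<Longrightarrow> decomposes G x c"
proof -
  assume a: "\<And>d. c d \<in> G d" "finite D" "\<And>d. d \<notin> D \<Longrightarrow> c d = 0" "(\<Sum>d\<in>D. c d) = x"
  have D: "{d. c d \<noteq> 0} \<subseteq> D" using a(3) by blast
  have "(\<Sum>d | c d \<noteq> 0. c d) = (\<Sum>d\<in>D. c d)"
    by (rule sum.mono_neutral_left[OF a(2) D]) simp
  then show ?thesis unfolding decomposes_def using a(1,4) finite_subset[OF D a(2)] by simp
qed

text \<open>Follows from uniqueness: termwise sums and multiples of decompositions are again
  decompositions.\<close>

lemma lin_on_hcomp: "lin_on s U s (hcomp G d)"
proof -
  have add: "hcomp G d (x + y) = hcomp G d x + hcomp G d y" if "x \<in> U" "y \<in> U" for x y
  proof (rule hcomp_eq)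
    let ?D = "{d. hcomp G d x \<noteq> 0} \<union> {d. hcomp G d y \<noteq> 0}"
    show "decomposes G (x + y) (\<lambda>d. hcomp G d x + hcomp G d y)"
      by (rule decomposesI[of _ ?D])
        (use that in \<open>auto simp: add_G hcomp_in finite_hcomp sum.distrib sum_decomposes[OF decomposes_hcomp]\<close>)
  qed (use that add_U in auto)
  have "hcomp G d (s r x) = s r (hcomp G d x)" if "x \<in> U" for r x
  proof (rule hcomp_eq)
    show "decomposes G (s r x) (\<lambda>d. s r (hcomp G d x))"
      by (rule decomposesI[of _ "{d. hcomp G d x \<noteq> 0}"])
        (use that in \<open>auto simp: scale_G hcomp_in finite_hcomp scale_sum_right[symmetric]
           sum_decomposes[OF decomposes_hcomp]\<close>)
  qed (use that scale_U in auto)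
  with add show ?thesis by (auto simp: lin_on_def)
qed

lemma hcomp_0 [simp]: "hcomp G d 0 = 0"
  using hcomp_homog[OF zero_G] by simp

lemma homog_set: "homog G ds xs \<Longrightarrow> set xs \<subseteq> U"
  using G_U by (auto simp: list_all2_conv_all_nth in_set_conv_nth subset_iff)

lemma homog_hcomp: "length ds = length xs \<Longrightarrow> set xs \<subseteq> U \<Longrightarrow> homog G ds (map2 (hcomp G) ds xs)"
  by (auto simp: list_all2_conv_all_nth hcomp_in subset_iff)

end

text \<open>A grading given by projections \<open>pr d\<close>. They provide a decomposition;
  applied to an arbitrary decomposition, additivity and \<open>pr_homog\<close> recover each of its
  components, which gives uniqueness.\<close>

lemma gradedI:
  fixes s :: "'k::field \<Rightarrow> 'a::ab_group_add \<Rightarrow> 'a"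
  assumes "vector_space s" and U: "module.subspace s U" and G: "\<And>d. module.subspace s (G d)"
    and sub: "\<And>d. G d \<subseteq> U"
    and fin: "finite D"
    and pr_in: "\<And>d x. x \<in> U \<Longrightarrow> pr d x \<in> G d"
    and pr_out: "\<And>d x. x \<in> U \<Longrightarrow> d \<notin> D \<Longrightarrow> pr d x = 0"
    and pr_sum: "\<And>x. x \<in> U \<Longrightarrow> (\<Sum>d\<in>D. pr d x) = x"
    and pr_add: "\<And>d x y. x \<in> U \<Longrightarrow> y \<in> U \<Longrightarrow> pr d (x + y) = pr d x + pr d y"
    and pr_homog: "\<And>d e x. x \<in> G e \<Longrightarrow> pr d x = (if d = e then x else 0)"
  shows "graded s U G"
proof -
  interpret vector_space s by fact
  show ?thesis
  proof
    show "subspace U" "subspace (G d)" "G d \<subseteq> U" for d by fact+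
    fix x assume x: "x \<in> U"
    have pr_sum_dist: "pr d (sum f I) = (\<Sum>i\<in>I. pr d (f i))" if "finite I" "\<And>i. f i \<in> U"
      for d I and f :: "int \<Rightarrow> 'a"
      using that
    proof (induction I rule: finite_induct)
      case empty
      show ?case using pr_homog[of 0 d d] pr_homog[of 0 "d + 1" d] subspace_0[OF G] by simp
    next
      case (insert i I)
      then show ?case using pr_add[of "f i" "sum f I" d] subspace_sum[OF U, of I f] by simp
    qed
    show "\<exists>!c. decomposes G x c"
    proof (rule ex1I[of _ "\<lambda>d. pr d x"])
      have D: "{d. pr d x \<noteq> 0} \<subseteq> D" using pr_out[OF x] by blast
      have "(\<Sum>d | pr d x \<noteq> 0. pr d x) = (\<Sum>d\<in>D. pr d x)"
        by (rule sum.mono_neutral_left[OF fin D]) simp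
      then show "decomposes G x (\<lambda>d. pr d x)"
        unfolding decomposes_def using x pr_in finite_subset[OF D fin] pr_sum by simp
    next
      fix c assume c: "decomposes G x c"
      show "c = (\<lambda>d. pr d x)"
      proof
        fix d
        have fc: "finite {d. c d \<noteq> 0}" and cG: "\<And>d. c d \<in> G d" and cx: "(\<Sum>d | c d \<noteq> 0. c d) = x"
          using c by (auto simp: decomposes_def)
        have "pr d x = (\<Sum>e | c e \<noteq> 0. pr d (c e))"
          unfolding cx[symmetric] using cG sub by (intro pr_sum_dist[OF fc]) blast
        also have "\<dots> = (\<Sum>e | c e \<noteq> 0. if d = e then c e else 0)"
          using pr_homog[OF cG] by (intro sum.cong) auto
        also have "\<dots> = c d" using fc by auto
        finally show "c d = pr d x" by simp
      qed
    qed
  qed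
qed

section \<open>Extension of formulas from homogeneous arguments\<close>

locale finite_graded = graded s U G
  for s :: "'k::field \<Rightarrow> 'a::ab_group_add \<Rightarrow> 'a" and U :: "'a set" and G :: "int \<Rightarrow> 'a set" +
  assumes finite_degs: "finite (degs G)"
begin

lemma hcomp_degs: "x \<in> U \<Longrightarrow> d \<notin> degs G \<Longrightarrow> hcomp G d x = 0"
  using hcomp_in[of x d] by (simp add: degs_def)

lemma sum_hcomp: "x \<in> U \<Longrightarrow> (\<Sum>d\<in>degs G. hcomp G d x) = x"
  by (rule sum_decomposes[OF decomposes_hcomp finite_degs]) (use hcomp_degs in auto)

lemma finite_deg_lists: "finite {ds. length ds = n \<and> set ds \<subseteq> degs G}"
  using finite_lists_length_eq[OF finite_degs, of n] by (simp add: conj_commute)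

lemma sum_homog:
  assumes "x \<in> G d" "f d x = 0 \<or> d \<in> degs G" "\<And>i. f i 0 = 0"
  shows "(\<Sum>i\<in>degs G. f i (hcomp G i x)) = f d x"
proof -
  have "(\<Sum>i\<in>degs G. f i (hcomp G i x)) = (\<Sum>i\<in>degs G. if i = d then f d x else 0)"
    by (intro sum.cong) (auto simp: hcomp_homog[OF assms(1)] assms(3))
  also have "\<dots> = f d x" using assms(2) finite_degs by auto
  finally show ?thesis .
qed

lemma sum_homog0:
  assumes "x \<in> G d" "\<And>i. f i 0 = 0"
  shows "(\<Sum>i\<in>degs G. f i (hcomp G i x)) = f d x"
  using assms by (intro sum_homog) (auto simp: degs_def)

text \<open>If a homogeneous word is split along a degree list other than its own, some entry
  becomes 0, and \<open>zero\<close> kills that term. The same hypothesis covers a list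
  \<open>ds\<close> with an entry outside \<open>degs G\<close>, over which the sum in
  \<open>kext\<close> does not range: the letter in question is then 0.\<close>

lemma kext_homog:
  assumes h: "homog G ds xs"
    and zero: "\<And>ds' xs'. homog G ds' xs' \<Longrightarrow> length xs' = length xs \<Longrightarrow> 0 \<in> set xs' \<Longrightarrow> \<Phi> ds' xs' = 0"
  shows "kext G \<Phi> xs = \<Phi> ds xs"
proof -
  have len: "length ds = length xs" using h by (rule list_all2_lengthD)
  have other: "\<Phi> ds' (map2 (hcomp G) ds' xs) = 0" if l: "length ds' = length xs" and ne: "ds' \<noteq> ds" for ds'
  proof (rule zero)
    show "homog G ds' (map2 (hcomp G) ds' xs)" by (rule homog_hcomp[OF l homog_set[OF h]])
    show "length (map2 (hcomp G) ds' xs) = length xs" using l by simp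
    obtain i where i: "i < length xs" "ds' ! i \<noteq> ds ! i"
      using l ne len by (metis nth_equalityI)
    have "xs ! i \<in> G (ds ! i)" using h i by (simp add: list_all2_conv_all_nth)
    then have "map2 (hcomp G) ds' xs ! i = 0" using i l by (simp add: hcomp_homog)
    then show "0 \<in> set (map2 (hcomp G) ds' xs)"
      using i l by (metis length_map length_zip min.idem nth_mem)
  qed
  have same: "map2 (hcomp G) ds xs = xs"
    by (rule nth_equalityI) (use h len in \<open>auto simp: list_all2_conv_all_nth hcomp_homog\<close>)
  show ?thesis
  proof (cases "set ds \<subseteq> degs G")
    case True
    have "kext G \<Phi> xs = (\<Sum>ds' | length ds' = length xs \<and> set ds' \<subseteq> degs G. if ds' = ds then \<Phi> ds xs else 0)"
      unfolding kext_def by (intro sum.cong) (auto simp: other same)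
    also have "\<dots> = \<Phi> ds xs" using True len finite_deg_lists by (simp add: sum.delta)
    finally show ?thesis .
  next
    case False
    have "kext G \<Phi> xs = 0" unfolding kext_def
      using False by (intro sum.neutral) (auto intro!: other)
    moreover obtain i where i: "i < length ds" "G (ds ! i) = {0}"
      using False by (auto simp: in_set_conv_nth degs_def subset_iff)
    have "0 \<in> set xs" using h i len by (force simp: list_all2_conv_all_nth in_set_conv_nth)
    then have "\<Phi> ds xs = 0" by (intro zero[OF h]) auto
    ultimately show ?thesis by simp
  qed
qed

lemma kext_cong:
  assumes "set xs \<subseteq> U" "\<And>ds ys. homog G ds ys \<Longrightarrow> length ys = length xs \<Longrightarrow> \<Phi> ds ys = \<Psi> ds ys"
  shows "kext G \<Phi> xs = kext G \<Psi> xs"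
  unfolding kext_def using assms by (intro sum.cong refl assms(2) homog_hcomp) auto

lemma lin_on_zero_arg: "lin_on s U s' f \<Longrightarrow> f 0 = 0"
  using zero_U unfolding lin_on_def by (metis add_cancel_right_right)

lemma lin_on_sum_arg:
  assumes "lin_on s U s' f" "\<And>i. i \<in> I \<Longrightarrow> g i \<in> U"
  shows "f (sum g I) = (\<Sum>i\<in>I. f (g i))"
proof -
  note z = lin_on_zero_arg[OF assms(1)]
  show ?thesis using assms(2)
  proof (induction I rule: infinite_finite_induct)
    case (insert i I)
    then show ?case using assms(1) sum_U[of I g] by (simp add: lin_on_def)
  qed (simp_all add: z)
qed

lemma multilinear_expand:
  assumes F: "multilinear_on s U s' n F" and "length xs = n" "set xs \<subseteq> U"
  shows "F xs = kext G (\<lambda>_. F) xs"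
proof -
  \<comment> \<open>The prefix \<open>us\<close> consists of slots that are already split, so the
    induction can open one slot at a time.\<close>
  have "F (us @ xs) = (\<Sum>ds | length ds = length xs \<and> set ds \<subseteq> degs G. F (us @ map2 (hcomp G) ds xs))"
    if "length us + length xs = n" "set us \<subseteq> U" "set xs \<subseteq> U" for us xs
    using that
  proof (induction xs arbitrary: us)
    case Nil
    have "{ds. length ds = 0 \<and> set ds \<subseteq> degs G} = {[]}" by auto
    then show ?case by simp
  next
    case (Cons x xs)
    have slot: "lin_on s U s' (\<lambda>x. F (us @ x # xs))"
      by (rule multilinear_on_slot[OF F]) (use Cons.prems zero_U in auto)
    have "F (us @ x # xs) = F (us @ (\<Sum>d\<in>degs G. hcomp G d x) # xs)"
      using Cons.prems by (simp add: sum_hcomp)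
    also have "\<dots> = (\<Sum>d\<in>degs G. F (us @ hcomp G d x # xs))"
      using Cons.prems by (intro lin_on_sum_arg[OF slot] hcomp_U) auto
    also have "\<dots> = (\<Sum>d\<in>degs G. \<Sum>ds | length ds = length xs \<and> set ds \<subseteq> degs G.
        F (us @ hcomp G d x # map2 (hcomp G) ds xs))"
    proof (intro sum.cong refl)
      fix d assume "d \<in> degs G"
      show "F (us @ hcomp G d x # xs) = (\<Sum>ds | length ds = length xs \<and> set ds \<subseteq> degs G.
          F (us @ hcomp G d x # map2 (hcomp G) ds xs))"
        using Cons.IH[of "us @ [hcomp G d x]"] Cons.prems G_U[OF hcomp_in, of x d] by simp
    qed
    also have "\<dots> = (\<Sum>ds | length ds = length (x # xs) \<and> set ds \<subseteq> degs G.
        F (us @ map2 (hcomp G) ds (x # xs)))"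
      by (simp add: sum_lists_Suc)
    finally show ?case .
  qed
  from this[of "[]" xs] show ?thesis using assms by (simp add: kext_def)
qed

lemma multilinear_on_zero:
  assumes "multilinear_on s U s' n F" "length xs = n" "set xs \<subseteq> U" "0 \<in> set xs"
  shows "F xs = 0"
proof -
  obtain i where "i < n" "xs ! i = 0" using assms by (auto simp: in_set_conv_nth)
  then show ?thesis
    using lin_on_zero_arg[OF multilinear_onD[OF assms(1-3), of i]] list_update_id[of xs i] by simp
qed

end

text \<open>The condition on the argument of \<open>kext\<close> under which the extension is multilinear.\<close>

definition hml :: "('k \<Rightarrow> 'a::ab_group_add \<Rightarrow> 'a) \<Rightarrow> (int \<Rightarrow> 'a set) \<Rightarrow> ('k \<Rightarrow> 'b::ab_group_add \<Rightarrow> 'b)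
    \<Rightarrow> nat \<Rightarrow> (int list \<Rightarrow> 'a list \<Rightarrow> 'b) \<Rightarrow> bool" where
  "hml s G s' n \<Phi> \<longleftrightarrow>
     (\<forall>ds xs i. homog G ds xs \<and> length xs = n \<and> i < n \<longrightarrow> lin_on s (G (ds ! i)) s' (\<lambda>x. \<Phi> ds (xs[i := x])))"

context finite_graded
begin

lemma hml_multilinear: "multilinear_on s U s' n F \<Longrightarrow> hml s G s' n (\<lambda>_. F)"
  unfolding hml_def
proof (intro allI impI, elim conjE)
  fix ds xs i assume "multilinear_on s U s' n F" "homog G ds xs" "length xs = n" "i < n"
  then show "lin_on s (G (ds ! i)) s' (\<lambda>x. F (xs[i := x]))"
    using lin_on_mono[OF multilinear_onD G_subset] homog_set by blast
qed

lemma hml_zero: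
  assumes "hml s G s' n \<Phi>" "homog G ds xs" "length xs = n" "0 \<in> set xs"
  shows "\<Phi> ds xs = 0"
proof -
  obtain i where i: "i < n" "xs ! i = 0" using assms by (auto simp: in_set_conv_nth)
  then have "lin_on s (G (ds ! i)) s' (\<lambda>x. \<Phi> ds (xs[i := x]))"
    using assms unfolding hml_def by blast
  then have "\<Phi> ds (xs[i := 0 + 0]) = \<Phi> ds (xs[i := 0]) + \<Phi> ds (xs[i := 0])"
    unfolding lin_on_def using zero_G by blast
  then show ?thesis using i list_update_id[of xs i] by simp
qed

lemma kext_hml: "hml s G s' n \<Phi> \<Longrightarrow> homog G ds xs \<Longrightarrow> length xs = n \<Longrightarrow> kext G \<Phi> xs = \<Phi> ds xs"
  by (rule kext_homog) (auto intro: hml_zero)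

lemma map2_hcomp_update:
  "i < length ds \<Longrightarrow> map2 (hcomp G) ds (xs[i := x]) = (map2 (hcomp G) ds xs)[i := hcomp G (ds ! i) x]"
  using zip_update[of ds i "ds ! i" xs x] by (simp add: map_update)

text \<open>Composing with the linear projections \<open>hcomp G d\<close>, whose values lie in
  \<open>G d\<close>, turns linearity on each piece into linearity on \<open>U\<close>.\<close>

lemma kext_multilinear:
  assumes "vector_space s'" "hml s G s' n \<Phi>"
  shows "multilinear_on s U s' n (kext G \<Phi>)"
proof -
  interpret vs': vector_space s' by fact
  show ?thesis unfolding multilinear_on_iff
  proof (intro allI impI, elim conjE)
    fix xs i assume *: "length xs = n" "set xs \<subseteq> U" "i < n"
    have "kext G \<Phi> (xs[i := x]) = (\<Sum>ds | length ds = n \<and> set ds \<subseteq> degs G.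
        \<Phi> ds ((map2 (hcomp G) ds xs)[i := hcomp G (ds ! i) x]))" for x
      unfolding kext_def using * by (intro sum.cong) (auto simp: map2_hcomp_update)
    moreover have "lin_on s U s' (\<lambda>x. \<Phi> ds ((map2 (hcomp G) ds xs)[i := hcomp G (ds ! i) x]))"
      if "length ds = n" for ds
    proof -
      have "lin_on s (G (ds ! i)) s' (\<lambda>x. \<Phi> ds ((map2 (hcomp G) ds xs)[i := x]))"
        using assms(2) * that homog_hcomp[of ds xs] unfolding hml_def by simp
      then show ?thesis
        using lin_on_hcomp[of "ds ! i"] hcomp_in[of _ "ds ! i"] unfolding lin_on_def by auto
    qed
    ultimately show "lin_on s U s' (\<lambda>x. kext G \<Phi> (xs[i := x]))"
      by (simp only:) (rule vs'.lin_on_sum, simp)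
  qed
qed

lemma kext_multilinear_on:
  assumes "multilinear_on s U s' n F" "vector_space s'" "length xs = n" "set xs \<subseteq> U"
    and "\<And>ds ys. homog G ds ys \<Longrightarrow> length ys = n \<Longrightarrow> \<Phi> ds ys = F ys"
  shows "kext G \<Phi> xs = F xs"
proof -
  have "kext G \<Phi> xs = kext G (\<lambda>_. F) xs" by (rule kext_cong) (use assms in auto)
  then show ?thesis using multilinear_expand[OF assms(1,3,4)] by simp
qed

lemma multilinear_ext:
  assumes "multilinear_on s U s' n F" "multilinear_on s U s' n F'" "vector_space s'"
    and "length xs = n" "set xs \<subseteq> U"
    and "\<And>ds ys. homog G ds ys \<Longrightarrow> length ys = n \<Longrightarrow> F ys = F' ys"
  shows "F xs = F' xs"
  using kext_multilinear_on[OF assms(2-5), of "\<lambda>_. F"] multilinear_expand[OF assms(1,4,5)] assms(6)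
  by simp

section \<open>Shifted maps\<close>

lemma shift_homog:
  assumes "homog G ds xs" "length xs = k"
    and "\<And>ds' xs'. homog G ds' xs' \<Longrightarrow> length xs' = k \<Longrightarrow> 0 \<in> set xs' \<Longrightarrow> q xs' = 0"
  shows "shift G k q xs = ksg (\<Sum>j<k. (int k - 1 - int j) * (ds ! j - 1)) (q xs)"
  unfolding shift_def by (rule kext_homog) (use assms in auto)

lemma multilinear_shift:
  assumes "vector_space s'" "multilinear_on s U s' k q"
  shows "multilinear_on s U s' k (shift G k q)"
proof -
  interpret vs': vector_space s' by fact
  show ?thesis unfolding shift_def
    using hml_multilinear[OF assms(2)]
    by (intro kext_multilinear assms(1)) (auto simp: hml_def intro: vs'.lin_on_ksg)
qed

lemma shift_multilinear_homog:
  assumes "multilinear_on s U s' k q" "homog G ds xs" "length xs = k"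
  shows "shift G k q xs = ksg (\<Sum>j<k. (int k - 1 - int j) * (ds ! j - 1)) (q xs)"
  by (rule shift_homog) (use assms multilinear_on_zero[OF assms(1)] homog_set in auto)

lemma shift_shift:
  assumes "vector_space s'" "multilinear_on s U s' k q" "length xs = k" "set xs \<subseteq> U"
  shows "shift G k (shift G k q) xs = q xs"
proof (rule multilinear_ext[OF _ assms(2,1,3,4)])
  show "multilinear_on s U s' k (shift G k (shift G k q))"
    using assms by (intro multilinear_shift)
  fix ds ys assume *: "homog G ds ys" "length ys = k"
  show "shift G k (shift G k q) ys = q ys"
    using shift_multilinear_homog[OF multilinear_shift[OF assms(1,2)] *]
      shift_multilinear_homog[OF assms(2) *] by (simp add: ksg_def)
qed

end

section \<open>Products and duals of graded spaces\<close>

text \<open>If no element of a finite spanning set has a component of degree d, the linear map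
  \<open>hcomp G d\<close> vanishes identically and \<open>G d\<close> is zero. So only the finitely
  many degrees that occur in the spanning set survive.\<close>

lemma fd_graded_space_finite_graded:
  assumes "fd_graded_space s G"
  shows "finite_graded s UNIV G"
proof -
  interpret vector_space s using assms by (simp add: fd_graded_space_def)
  interpret graded s UNIV G
    using assms by unfold_locales (auto simp: fd_graded_space_def)
  obtain B where B: "finite B" "span B = UNIV"
    using assms by (auto simp: fd_graded_space_def)
  have "degs G \<subseteq> (\<Union>b\<in>B. {d. hcomp G d b \<noteq> 0})"
  proof
    fix d assume "d \<in> degs G"
    then obtain x where x: "x \<in> G d" "x \<noteq> 0" using zero_G[of d] by (auto simp: degs_def)
    show "d \<in> (\<Union>b\<in>B. {d. hcomp G d b \<noteq> 0})"
    proof (rule ccontr)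
      assume "d \<notin> (\<Union>b\<in>B. {d. hcomp G d b \<noteq> 0})"
      then have "B \<subseteq> {y. hcomp G d y = 0}" by auto
      moreover have "subspace {y. hcomp G d y = 0}"
        using lin_on_hcomp[of d] unfolding lin_on_def by (intro subspaceI) auto
      ultimately have "span B \<subseteq> {y. hcomp G d y = 0}" by (rule span_minimal)
      then have "hcomp G d x = 0" using B(2) by blast
      then show False using x hcomp_homog[OF x(1), of d] by simp
    qed
  qed
  then show ?thesis
    using B finite_hcomp by unfold_locales (auto intro: finite_subset)
qed

lemma finite_graded_times:
  assumes "finite_graded s U G" "finite_graded s' U' G'"
  shows "finite_graded (\<lambda>r x. (s r (fst x), s' r (snd x))) (U \<times> U') (\<lambda>d. G d \<times> G' d)"
proof -
  interpret A: finite_graded s U G by fact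
  interpret B: finite_graded s' U' G' by fact
  let ?s = "\<lambda>r x. (s r (fst x), s' r (snd x))"
  have vs: "vector_space ?s"
    by unfold_locales (auto simp: A.scale_right_distrib B.scale_right_distrib A.scale_left_distrib
        B.scale_left_distrib)
  interpret P: vector_space ?s by (rule vs)
  have sub: "P.subspace (S \<times> S')" if "A.subspace S" "B.subspace S'" for S S'
    using that unfolding P.subspace_def A.subspace_def B.subspace_def by (auto simp: zero_prod_def)
  have degs: "degs (\<lambda>d. G d \<times> G' d) \<subseteq> degs G \<union> degs G'"
    by (auto simp: degs_def zero_prod_def)
  interpret graded ?s "U \<times> U'" "\<lambda>d. G d \<times> G' d"
  proof (rule gradedI[where D = "degs G \<union> degs G'" and pr = "\<lambda>d x. (hcomp G d (fst x), hcomp G' d (snd x))"])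
    fix x assume x: "x \<in> U \<times> U'"
    have "(\<Sum>d\<in>degs G \<union> degs G'. hcomp G d (fst x)) = (\<Sum>d\<in>degs G. hcomp G d (fst x))"
      "(\<Sum>d\<in>degs G \<union> degs G'. hcomp G' d (snd x)) = (\<Sum>d\<in>degs G'. hcomp G' d (snd x))"
      using x by (intro sum.mono_neutral_right; auto simp: A.finite_degs B.finite_degs A.hcomp_degs B.hcomp_degs)+
    then show "(\<Sum>d\<in>degs G \<union> degs G'. (hcomp G d (fst x), hcomp G' d (snd x))) = x"
      using x by (auto simp: prod_eq_iff fst_sum snd_sum A.sum_hcomp B.sum_hcomp)
  next
    show "(hcomp G d (fst (x + y)), hcomp G' d (snd (x + y)))
        = (hcomp G d (fst x), hcomp G' d (snd x)) + (hcomp G d (fst y), hcomp G' d (snd y))"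
      if "x \<in> U \<times> U'" "y \<in> U \<times> U'" for d x y
      using that A.lin_on_hcomp[of d] B.lin_on_hcomp[of d] by (auto simp: lin_on_def mem_Times_iff)
  qed (auto simp: vs A.finite_degs B.finite_degs A.hcomp_in B.hcomp_in A.hcomp_degs B.hcomp_degs
      A.hcomp_homog B.hcomp_homog zero_prod_def mem_Times_iff A.G_U B.G_U
      intro: sub A.subspace_U B.subspace_U A.subspace_G B.subspace_G)
  show ?thesis
    using degs A.finite_degs B.finite_degs by unfold_locales (auto intro: finite_subset)
qed

lemma vector_space_fun: "vector_space (\<lambda>(r::'k::field) (f :: 'a \<Rightarrow> 'k) y. r * f y)"
  by unfold_locales (auto simp: fun_eq_iff algebra_simps)

lemma vector_space_mult: "vector_space ((*) :: 'k::field \<Rightarrow> 'k \<Rightarrow> 'k)"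
  by unfold_locales (auto simp: algebra_simps)

lemma sum_fun_apply: "(\<Sum>i\<in>I. f i) x = (\<Sum>i\<in>I. f i x)"
  by (induction I rule: infinite_finite_induct) auto

text \<open>The component of degree d of a functional is its composition with the projection to
  degree -d. As \<open>degs G\<close> is finite, a functional is the finite sum of these
  components.\<close>

lemma finite_graded_dual:
  fixes s :: "'k::field \<Rightarrow> 'a::ab_group_add \<Rightarrow> 'a"
  assumes "finite_graded s UNIV G"
  shows "finite_graded (\<lambda>r f y. r * f y) {f. Vector_Spaces.linear s (*) f} (dual_gr s G)"
proof -
  interpret A: finite_graded s UNIV G by fact
  let ?s = "\<lambda>r f y. r * f y :: 'k"
  let ?U = "{f. Vector_Spaces.linear s (*) f}"
  interpret P: vector_space ?s by (rule vector_space_fun)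
  have lin: "Vector_Spaces.linear s (*) f \<longleftrightarrow> (\<forall>x y. f (x + y) = f x + f y) \<and> (\<forall>r x. f (s r x) = r * f x)" for f
    by (simp add: Vector_Spaces.linear_iff A.vector_space_axioms vector_space_mult)
  have sub: "P.subspace ?U" "P.subspace (dual_gr s G d)" for d
    unfolding P.subspace_def dual_gr_def lin by (auto simp: algebra_simps)
  have degs: "degs (dual_gr s G) \<subseteq> uminus ` degs G"
  proof
    fix d assume "d \<in> degs (dual_gr s G)"
    moreover have "0 \<in> dual_gr s G d" using sub(2) by (rule P.subspace_0)
    ultimately obtain f where f: "f \<in> dual_gr s G d" "f \<noteq> 0" by (auto simp: degs_def)
    have "- d \<in> degs G"
    proof (rule ccontr)
      assume nd: "- d \<notin> degs G"
      have fl: "Vector_Spaces.linear s (*) f" using f by (simp add: dual_gr_def)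
      have "f x = 0" for x
      proof -
        have "f x = (\<Sum>i\<in>degs G. f (hcomp G i x))"
          using A.sum_hcomp[of x] linear_sum'[OF fl, of "\<lambda>i. hcomp G i x" "degs G"] by simp
        also have "\<dots> = 0"
        proof (intro sum.neutral ballI)
          fix i assume "i \<in> degs G"
          then have "i \<noteq> - d" using nd by auto
          then show "f (hcomp G i x) = 0" using f(1) A.hcomp_in[of x i] by (simp add: dual_gr_def)
        qed
        finally show ?thesis .
      qed
      then show False using f by auto
    qed
    then show "d \<in> uminus ` degs G" by (intro image_eqI[of _ _ "- d"]) auto
  qed
  have hl: "Vector_Spaces.linear s (*) (\<lambda>y. f (hcomp G d y))" if "Vector_Spaces.linear s (*) f" for f d
    using A.lin_on_hcomp[of d] that unfolding lin_on_def lin by simp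
  interpret graded ?s ?U "dual_gr s G"
  proof (rule gradedI[where D = "uminus ` degs G" and pr = "\<lambda>d f y. f (hcomp G (- d) y)"])
    fix d e and f
    assume f: "f \<in> dual_gr s G e"
    then have fl: "Vector_Spaces.linear s (*) f" by (simp add: dual_gr_def)
    show "(\<lambda>y. f (hcomp G (- d) y)) = (if d = e then f else 0)"
    proof
      fix y
      have v: "f (hcomp G i y) = 0" if "i \<noteq> - e" for i
        using f that A.hcomp_in[of y i] by (auto simp: dual_gr_def)
      have "f y = (\<Sum>i\<in>degs G. f (hcomp G i y))"
        using A.sum_hcomp[of y] linear_sum'[OF fl, of "\<lambda>i. hcomp G i y" "degs G"] by simp
      also have "\<dots> = (\<Sum>i\<in>degs G. if i = - e then f (hcomp G (- e) y) else 0)"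
        by (intro sum.cong) (auto simp: v)
      also have "\<dots> = f (hcomp G (- e) y)"
        using A.hcomp_degs[of y "- e"] linear_zero[OF fl] by (auto simp: A.finite_degs)
      finally show "f (hcomp G (- d) y) = (if d = e then f else 0) y"
        using v[of "- d"] by simp
    qed
  next
    fix f assume f: "f \<in> ?U"
    show "(\<Sum>d\<in>uminus ` degs G. (\<lambda>y. f (hcomp G (- d) y))) = f"
    proof
      fix y
      have "(\<Sum>d\<in>uminus ` degs G. (\<lambda>y. f (hcomp G (- d) y))) y = (\<Sum>d\<in>uminus ` degs G. f (hcomp G (- d) y))"
        by (rule sum_fun_apply)
      also have "\<dots> = (\<Sum>i\<in>degs G. f (hcomp G i y))"
        by (subst sum.reindex) auto
      also have "\<dots> = f y"
        using f A.sum_hcomp[of y] linear_sum'[of s "(*)" f "\<lambda>i. hcomp G i y" "degs G"] by simp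
      finally show "(\<Sum>d\<in>uminus ` degs G. (\<lambda>y. f (hcomp G (- d) y))) y = f y" .
    qed
  next
    fix d f assume "f \<in> ?U" then show "(\<lambda>y. f (hcomp G (- d) y)) \<in> dual_gr s G d"
      using hl[of f "- d"] linear_zero[of s "(*)" f] by (auto simp: dual_gr_def A.hcomp_homog)
  next
    fix d f assume f: "f \<in> ?U" and "d \<notin> uminus ` degs G"
    then have "- d \<notin> degs G" by (metis image_eqI minus_minus)
    then show "(\<lambda>y. f (hcomp G (- d) y)) = 0"
      using f linear_zero[of s "(*)" f] by (auto simp: A.hcomp_degs)
  qed (use sub P.vector_space_axioms A.finite_degs in \<open>auto simp: dual_gr_def\<close>)
  show ?thesis
    using degs A.finite_degs by unfold_locales (auto intro: finite_subset)
qed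

section \<open>The double semidirect product\<close>

lemma homog_2:
  assumes "homog G ds xs" "length xs = 2"
  obtains d d' x x' where "ds = [d, d']" "xs = [x, x']" "x \<in> G d" "x' \<in> G d'"
proof -
  obtain x x' where xs: "xs = [x, x']"
    using assms(2) by (metis One_nat_def Suc_1 length_0_conv length_Suc_conv)
  then obtain d d' where "ds = [d, d']" "x \<in> G d" "x' \<in> G d'"
    using assms(1) by (auto simp: list_all2_Cons2)
  then show ?thesis using xs that by blast
qed

lemma multilinear_on_2I:
  assumes "\<And>y. y \<in> U \<Longrightarrow> lin_on s U s' (\<lambda>x. F [x, y])" "\<And>x. x \<in> U \<Longrightarrow> lin_on s U s' (\<lambda>y. F [x, y])"
  shows "multilinear_on s U s' 2 F"
  unfolding multilinear_on_iff
proof (intro allI impI, elim conjE)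
  fix xs i assume *: "length xs = 2" "set xs \<subseteq> U" "i < (2::nat)"
  then obtain x y where xs: "xs = [x, y]"
    by (metis One_nat_def Suc_1 length_0_conv length_Suc_conv)
  from *(3) consider "i = 0" | "i = 1" by linarith
  then show "lin_on s U s' (\<lambda>x. F (xs[i := x]))"
    by cases (use * assms xs in auto)
qed

lemma graded_bilinearD:
  assumes "graded_bilinear s1 G1 s2 G2 s3 G3 m"
  shows "Vector_Spaces.linear s2 s3 (m x)" "Vector_Spaces.linear s1 s3 (\<lambda>x. m x y)"
    and "x \<in> G1 i \<Longrightarrow> y \<in> G2 j \<Longrightarrow> m x y \<in> G3 (i + j)"
  using assms by (auto simp: graded_bilinear_def)

lemma graded_bilinear_zero:
  assumes "graded_bilinear s1 G1 s2 G2 s3 G3 m"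
  shows "m 0 y = 0" "m x 0 = 0"
  using linear_zero[OF graded_bilinearD(1)[OF assms]] linear_zero[OF graded_bilinearD(2)[OF assms]]
  by auto

section \<open>Homogeneous functionals and the dual actions\<close>

lemma dual_gr_linear: "f \<in> dual_gr s G e \<Longrightarrow> Vector_Spaces.linear s (*) f"
  by (simp add: dual_gr_def)

lemma dual_gr_vanish: "f \<in> dual_gr s G e \<Longrightarrow> x \<in> G i \<Longrightarrow> i + e \<noteq> 0 \<Longrightarrow> f x = 0"
  by (simp add: dual_gr_def eq_neg_iff_add_eq_0)

lemma dual_lact_homog:
  assumes "finite_graded s UNIV G" "graded_bilinear s G s1 G1 s2 G2 m"
    "Vector_Spaces.linear s2 (*) f" "y \<in> G i"
  shows "dual_lact G m d e x f y = ksg (d * (e + i)) (f (m y x))"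
  unfolding dual_lact_def using assms(1,4)
  by (rule finite_graded.sum_homog0[where f = "\<lambda>i y. ksg (d * (e + i)) (f (m y x))"])
    (simp add: graded_bilinear_zero[OF assms(2)] linear_zero[OF assms(3)])

lemma dual_lact_in:
  assumes "finite_graded s UNIV G" "graded_bilinear s G s1 G1 s2 G2 m"
    "f \<in> dual_gr s2 G2 e" "x \<in> G1 d"
  shows "dual_lact G m d e x f \<in> dual_gr s G (d + e)"
proof -
  interpret finite_graded s UNIV G by fact
  interpret k: vector_space "(*)" by (rule vector_space_mult)
  note f = dual_gr_linear[OF assms(3)]
  have "lin_on s UNIV (*) (dual_lact G m d e x f)"
    unfolding dual_lact_def
    by (intro k.lin_on_sum k.lin_on_ksg lin_on_comp[OF f] lin_on_comp[OF graded_bilinearD(2)[OF assms(2)]]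
        lin_on_hcomp)
  then have "Vector_Spaces.linear s (*) (dual_lact G m d e x f)"
    unfolding Vector_Spaces.linear_iff lin_on_def by (simp add: vector_space_axioms vector_space_mult)
  moreover have "dual_lact G m d e x f y = 0" if "i \<noteq> - (d + e)" "y \<in> G i" for i y
    using that dual_lact_homog[OF assms(1,2) f that(2)]
      dual_gr_vanish[OF assms(3) graded_bilinearD(3)[OF assms(2) that(2) assms(4)]] by simp
  ultimately show ?thesis by (simp add: dual_gr_def)
qed

lemma dual_ract_in:
  assumes "vector_space s" "graded_bilinear s1 G1 s G s2 G2 m" "f \<in> dual_gr s2 G2 e" "x \<in> G1 d"
  shows "dual_ract m f x \<in> dual_gr s G (d + e)"
proof -
  note f = dual_gr_linear[OF assms(3)]
  have "Vector_Spaces.linear s (*) (\<lambda>y. f (m x y))"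
    unfolding Vector_Spaces.linear_iff
    by (simp add: assms(1) vector_space_mult linear_plus[OF f] linear_scale'[OF f]
        linear_plus[OF graded_bilinearD(1)[OF assms(2)]] linear_scale'[OF graded_bilinearD(1)[OF assms(2)]])
  moreover have "f (m x y) = 0" if "i \<noteq> - (d + e)" "y \<in> G i" for i y
    using that dual_gr_vanish[OF assms(3) graded_bilinearD(3)[OF assms(2,4) that(2)]] by simp
  ultimately show ?thesis by (simp add: dual_gr_def dual_ract_def)
qed

abbreviation vpart :: "('k, 'v, 'm) tilde \<Rightarrow> 'v" where "vpart v \<equiv> fst v"
abbreviation mpart :: "('k, 'v, 'm) tilde \<Rightarrow> 'm" where "mpart v \<equiv> fst (snd v)"
abbreviation vdual :: "('k, 'v, 'm) tilde \<Rightarrow> 'v \<Rightarrow> 'k" where "vdual v \<equiv> fst (snd (snd v))"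
abbreviation mdual :: "('k, 'v, 'm) tilde \<Rightarrow> 'm \<Rightarrow> 'k" where "mdual v \<equiv> snd (snd (snd v))"

text \<open>Half of the quadratic form: \<open>tform\<close> is its graded symmetrization.\<close>

definition eval_pair :: "('k::ring, 'v, 'm) tilde \<Rightarrow> ('k, 'v, 'm) tilde \<Rightarrow> 'k" where
  "eval_pair v w = vdual v (vpart w) + mdual v (mpart w)"

locale graded_bimod =
  fixes A :: "('k::field, 'v::ab_group_add, 'm::ab_group_add) gbimod"
  assumes bimodule: "graded_bimodule A"
begin

sublocale V: finite_graded "vscale A" UNIV "vgr A"
  using bimodule by (intro fd_graded_space_finite_graded) (simp add: graded_bimodule_def)

sublocale M: finite_graded "mscale A" UNIV "mgr A"
  using bimodule by (intro fd_graded_space_finite_graded) (simp add: graded_bimodule_def)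

sublocale W: finite_graded "\<lambda>r x. (vscale A r (fst x), mscale A r (snd x))" UNIV "wgr A"
  using finite_graded_times[OF V.finite_graded_axioms M.finite_graded_axioms]
  by (simp add: wgr_def[abs_def])

sublocale T: finite_graded "tscale A" "tcarrier A" "tgr A"
proof -
  \<comment> \<open>Written with nested pairs, the scaling takes the shape that three uses of
    \<open>finite_graded_times\<close> produce.\<close>
  have "tscale A = (\<lambda>r x. (vscale A r (fst x), (\<lambda>r x. (mscale A r (fst x),
      (\<lambda>r x. ((\<lambda>y. r * fst x y), (\<lambda>b. r * snd x b))) r (snd x))) r (snd x)))"
    by (auto simp: tscale_def fun_eq_iff)
  moreover have "tgr A = (\<lambda>d. vgr A d \<times> mgr A d \<times> dual_gr (vscale A) (vgr A) d \<times> dual_gr (mscale A) (mgr A) d)"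
    by (auto simp: tgr_def fun_eq_iff)
  ultimately show "finite_graded (tscale A) (tcarrier A) (tgr A)"
    using finite_graded_times[OF V.finite_graded_axioms finite_graded_times[OF M.finite_graded_axioms
        finite_graded_times[OF finite_graded_dual[OF V.finite_graded_axioms]
          finite_graded_dual[OF M.finite_graded_axioms]]]]
    by (simp add: tcarrier_def)
qed

sublocale K: vector_space "(*) :: 'k \<Rightarrow> 'k \<Rightarrow> 'k"
  by (rule vector_space_mult)

lemma vmul_bilinear: "graded_bilinear (vscale A) (vgr A) (vscale A) (vgr A) (vscale A) (vgr A) (vmul A)"
  and lact_bilinear: "graded_bilinear (vscale A) (vgr A) (mscale A) (mgr A) (mscale A) (mgr A) (lact A)"
  and ract_bilinear: "graded_bilinear (mscale A) (mgr A) (vscale A) (vgr A) (mscale A) (mgr A) (ract A)"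
  using bimodule by (auto simp: graded_bimodule_def)

lemmas act_zero [simp] =
  graded_bilinear_zero[OF vmul_bilinear] graded_bilinear_zero[OF lact_bilinear]
  graded_bilinear_zero[OF ract_bilinear]

lemmas act_in =
  graded_bilinearD(3)[OF vmul_bilinear] graded_bilinearD(3)[OF lact_bilinear]
  graded_bilinearD(3)[OF ract_bilinear]

section \<open>The product and the form on homogeneous letters\<close>

lemma tgrD:
  assumes "v \<in> tgr A d"
  shows "vpart v \<in> vgr A d" "mpart v \<in> mgr A d"
    "vdual v \<in> dual_gr (vscale A) (vgr A) d" "mdual v \<in> dual_gr (mscale A) (mgr A) d"
  using assms by (auto simp: tgr_def)

lemma tcarrierD:
  assumes "v \<in> tcarrier A"
  shows "Vector_Spaces.linear (vscale A) (*) (vdual v)" "Vector_Spaces.linear (mscale A) (*) (mdual v)"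
  using assms by (auto simp: tcarrier_def)

text \<open>The integrand of \<open>tmul\<close>. The degrees are separate arguments because the
  left actions on the duals carry signs that the letters alone do not determine.\<close>

definition tprod :: "int \<Rightarrow> int \<Rightarrow> ('k, 'v, 'm) tilde \<Rightarrow> ('k, 'v, 'm) tilde \<Rightarrow> ('k, 'v, 'm) tilde" where
  "tprod d d' v w =
     (vmul A (vpart v) (vpart w),
      lact A (vpart v) (mpart w) + ract A (mpart v) (vpart w),
      dual_lact (vgr A) (vmul A) d d' (vpart v) (vdual w) + dual_ract (vmul A) (vdual v) (vpart w)
        + dual_lact (vgr A) (lact A) d d' (mpart v) (mdual w) + dual_ract (ract A) (mdual v) (mpart w),
      dual_lact (mgr A) (ract A) d d' (vpart v) (mdual w) + dual_ract (lact A) (mdual v) (vpart w))"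

lemma zero_parts [simp]: "vpart 0 = 0" "mpart 0 = 0" "vdual 0 = 0" "mdual 0 = 0"
  by (simp_all add: zero_prod_def)

lemma tprod_zero:
  assumes "v \<in> tcarrier A"
  shows "tprod d d' 0 v = 0" "tprod d d' v 0 = 0"
  using linear_zero[OF tcarrierD(1)[OF assms]] linear_zero[OF tcarrierD(2)[OF assms]]
  by (auto simp: tprod_def dual_lact_def dual_ract_def zero_prod_def fun_eq_iff)

lemma tprod_homog_zero:
  assumes "homog (tgr A) [d, d'] [v, w]" "0 \<in> {v, w}"
  shows "tprod d d' v w = 0"
  using assms tprod_zero[OF T.G_U, of v d d d'] tprod_zero[OF T.G_U, of w d' d d'] by fastforce

lemma tmul_homog:
  assumes "v \<in> tgr A d" "w \<in> tgr A d'"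
  shows "tmul A [v, w] = tprod d d' v w"
proof -
  have "tmul A [v, w] = (\<lambda>ds vs. tprod (ds ! 0) (ds ! 1) (vs ! 0) (vs ! 1)) [d, d'] [v, w]"
    unfolding tmul_def Let_def split_def tprod_def[symmetric]
  proof (rule T.kext_homog)
    fix ds' xs' assume *: "homog (tgr A) ds' xs'" "length xs' = length [v, w]" "0 \<in> set xs'"
    show "tprod (ds' ! 0) (ds' ! 1) (xs' ! 0) (xs' ! 1) = 0"
      using * by (elim homog_2) (simp_all add: tprod_homog_zero)
  qed (use assms in simp)
  then show ?thesis by simp
qed

lemma tprod_in:
  assumes "v \<in> tgr A d" "w \<in> tgr A d'"
  shows "tprod d d' v w \<in> tgr A (d + d')"
proof -
  note v = tgrD[OF assms(1)] and w = tgrD[OF assms(2)]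
  note VD = finite_graded_dual[OF V.finite_graded_axioms, THEN finite_graded.axioms(1)]
  note MD = finite_graded_dual[OF M.finite_graded_axioms, THEN finite_graded.axioms(1)]
  have "dual_lact (vgr A) (vmul A) d d' (vpart v) (vdual w) \<in> dual_gr (vscale A) (vgr A) (d + d')"
    "dual_lact (vgr A) (lact A) d d' (mpart v) (mdual w) \<in> dual_gr (vscale A) (vgr A) (d + d')"
    "dual_lact (mgr A) (ract A) d d' (vpart v) (mdual w) \<in> dual_gr (mscale A) (mgr A) (d + d')"
    using dual_lact_in[OF V.finite_graded_axioms vmul_bilinear w(3) v(1)]
      dual_lact_in[OF V.finite_graded_axioms lact_bilinear w(4) v(2)]
      dual_lact_in[OF M.finite_graded_axioms ract_bilinear w(4) v(1)] by auto
  moreover have "dual_ract (vmul A) (vdual v) (vpart w) \<in> dual_gr (vscale A) (vgr A) (d + d')"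
    "dual_ract (ract A) (mdual v) (mpart w) \<in> dual_gr (vscale A) (vgr A) (d + d')"
    "dual_ract (lact A) (mdual v) (vpart w) \<in> dual_gr (mscale A) (mgr A) (d + d')"
    using dual_ract_in[OF V.vector_space_axioms vmul_bilinear v(3) w(1)]
      dual_ract_in[OF V.vector_space_axioms ract_bilinear v(4) w(2)]
      dual_ract_in[OF M.vector_space_axioms lact_bilinear v(4) w(1)] by (auto simp: add.commute)
  ultimately show ?thesis
    using act_in(1)[OF v(1) w(1)] act_in(2)[OF v(1) w(2)] act_in(3)[OF v(2) w(1)]
    by (auto simp: tgr_def tprod_def intro!: graded.add_G[OF VD] graded.add_G[OF MD] M.add_G)
qed

lemma sum_lessThan_2: "(\<Sum>j<2. f j) = f 0 + f (Suc 0)"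
  by (simp add: numeral_2_eq_2)

lemma tQ_homog:
  assumes "v \<in> tgr A d" "w \<in> tgr A d'"
  shows "tQ A [v, w] = ksg (d - 1) (tprod d d' v w)"
proof -
  have "tQ A [v, w] = ksg (\<Sum>j<2. (int 2 - 1 - int j) * ([d, d'] ! j - 1)) (tmul A [v, w])"
    unfolding tQ_def
  proof (rule T.shift_homog)
    fix ds' xs' assume *: "homog (tgr A) ds' xs'" "length xs' = 2" "0 \<in> set xs'"
    show "tmul A xs' = 0"
      using *(1,2)
    proof (rule homog_2)
      fix d d' x x' assume "ds' = [d, d']" "xs' = [x, x']" "x \<in> tgr A d" "x' \<in> tgr A d'"
      then show ?thesis using *(3) tmul_homog[of x d x' d'] tprod_homog_zero[of d d' x x'] by simp
    qed
  qed (use assms in auto)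
  then show ?thesis using tmul_homog[OF assms] by (simp add: sum_lessThan_2)
qed

lemma tQ_in:
  assumes "v \<in> tgr A d" "w \<in> tgr A d'"
  shows "tQ A [v, w] \<in> tgr A (d + d')"
  unfolding tQ_homog[OF assms] by (intro T.ksg_G tprod_in assms)

lemma eval_pair_lin:
  "lin_on (tscale A) S (*) (\<lambda>v. eval_pair v w)"
  "v \<in> tcarrier A \<Longrightarrow> lin_on (tscale A) S (*) (eval_pair v)"
  using linear_plus[OF tcarrierD(1)] linear_plus[OF tcarrierD(2)]
    linear_scale'[OF tcarrierD(1)] linear_scale'[OF tcarrierD(2)]
  by (auto simp: lin_on_def eval_pair_def tscale_def split_def algebra_simps)

lemma eval_pair_vanish:
  assumes "v \<in> tgr A d" "w \<in> tgr A d'" "d + d' \<noteq> 0"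
  shows "eval_pair v w = 0"
  using tgrD[OF assms(1)] tgrD[OF assms(2)] assms(3)
    dual_gr_vanish[of "vdual v" "vscale A" "vgr A" d "vpart w" d']
    dual_gr_vanish[of "mdual v" "mscale A" "mgr A" d "mpart w" d']
  by (simp add: eval_pair_def add.commute)

lemma eval_pair_multilinear: "multilinear_on (tscale A) (tcarrier A) (*) 2 (\<lambda>vs. eval_pair (vs ! 0) (vs ! 1))"
  and eval_pair_multilinear': "multilinear_on (tscale A) (tcarrier A) (*) 2 (\<lambda>vs. eval_pair (vs ! 1) (vs ! 0))"
  by (rule multilinear_on_2I; simp add: eval_pair_lin)+

lemma tform_kext:
  "tform A = kext (tgr A) (\<lambda>ds vs. eval_pair (vs ! 0) (vs ! 1)
     + ksg (ds ! 0 * ds ! 1) (eval_pair (vs ! 1) (vs ! 0)))"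
  unfolding tform_def eval_pair_def Let_def split_def by simp

lemma tform_hml:
  "hml (tscale A) (tgr A) (*) 2 (\<lambda>ds vs. eval_pair (vs ! 0) (vs ! 1)
     + ksg (ds ! 0 * ds ! 1) (eval_pair (vs ! 1) (vs ! 0)))"
  using T.hml_multilinear[OF eval_pair_multilinear] T.hml_multilinear[OF eval_pair_multilinear']
  unfolding hml_def by (intro allI impI K.lin_on_add K.lin_on_ksg) blast+

lemma tform_multilinear: "multilinear_on (tscale A) (tcarrier A) (*) 2 (tform A)"
  unfolding tform_kext by (rule T.kext_multilinear[OF K.vector_space_axioms tform_hml])

lemma tB_multilinear: "multilinear_on (tscale A) (tcarrier A) (*) 2 (tB A)"
  unfolding tB_def by (rule T.multilinear_shift[OF K.vector_space_axioms tform_multilinear])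

lemma tform_homog:
  assumes "v \<in> tgr A d" "w \<in> tgr A d'"
  shows "tform A [v, w] = eval_pair v w + ksg (d * d') (eval_pair w v)"
  unfolding tform_kext using T.kext_hml[OF tform_hml, of "[d, d']" "[v, w]"] assms by simp

lemma tform_vanish:
  assumes "v \<in> tgr A d" "w \<in> tgr A d'" "d + d' \<noteq> 0"
  shows "tform A [v, w] = 0"
  using eval_pair_vanish[OF assms] eval_pair_vanish[OF assms(2,1)] assms(3)
  by (simp add: tform_homog[OF assms(1,2)] add.commute)

lemma tB_homog:
  assumes "v \<in> tgr A d" "w \<in> tgr A d'"
  shows "tB A [v, w] = ksg (d - 1) (tform A [v, w])"
  using T.shift_multilinear_homog[OF tform_multilinear, of "[d, d']" "[v, w]"] assms
  by (simp add: tB_def sum_lessThan_2)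

lemma tform_lin:
  "w \<in> tcarrier A \<Longrightarrow> lin_on (tscale A) (tcarrier A) (*) (\<lambda>v. tform A [v, w])"
  "v \<in> tcarrier A \<Longrightarrow> lin_on (tscale A) (tcarrier A) (*) (\<lambda>w. tform A [v, w])"
  using multilinear_on_slot[OF tform_multilinear, of "[]" "[w]"]
    multilinear_on_slot[OF tform_multilinear, of "[v]" "[]"] T.zero_U by auto

lemma tform_ksg:
  "w \<in> tcarrier A \<Longrightarrow> v \<in> tcarrier A \<Longrightarrow> tform A [ksg n v, w] = ksg n (tform A [v, w])"
  "w \<in> tcarrier A \<Longrightarrow> v \<in> tcarrier A \<Longrightarrow> tform A [v, ksg n w] = ksg n (tform A [v, w])"
proof -
  have neg: "lin_on (tscale A) (tcarrier A) (*) f \<Longrightarrow> u \<in> tcarrier A \<Longrightarrow> f (- u) = - f u"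
    for f :: "_ \<Rightarrow> 'k" and u
    using T.scale_minus_left[of 1 u] by (auto simp: lin_on_def dest: spec[of _ "- 1"])
  show "w \<in> tcarrier A \<Longrightarrow> v \<in> tcarrier A \<Longrightarrow> tform A [ksg n v, w] = ksg n (tform A [v, w])"
    "w \<in> tcarrier A \<Longrightarrow> v \<in> tcarrier A \<Longrightarrow> tform A [v, ksg n w] = ksg n (tform A [v, w])"
    using neg[OF tform_lin(1)] neg[OF tform_lin(2)] by (auto simp: ksg_def)
qed

lemma dual_lact_simps:
  assumes "v \<in> tgr A d" "w \<in> tgr A d'"
  shows "dual_lact (vgr A) (vmul A) e e' x (vdual v) (vpart w) = ksg (e * (e' + d')) (vdual v (vmul A (vpart w) x))"
    "dual_lact (vgr A) (lact A) e e' a (mdual v) (vpart w) = ksg (e * (e' + d')) (mdual v (lact A (vpart w) a))"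
    "dual_lact (mgr A) (ract A) e e' x (mdual v) (mpart w) = ksg (e * (e' + d')) (mdual v (ract A (mpart w) x))"
  using tgrD[OF assms(1)] tgrD[OF assms(2)]
  by (auto intro!: dual_lact_homog V.finite_graded_axioms M.finite_graded_axioms dual_gr_linear
      vmul_bilinear lact_bilinear ract_bilinear)

text \<open>Both sides are the same sum of three kinds of terms: the functional part of each letter
  is evaluated at the product, in the semidirect product of V and M, of the two letters that follow
  it cyclically.\<close>

lemma tform_invariant:
  assumes u: "u \<in> tgr A d1" and v: "v \<in> tgr A d2" and w: "w \<in> tgr A d3"
  shows "tform A [tprod d1 d2 u v, w] = tform A [u, tprod d2 d3 v w]"
proof -
  have lin: "vdual t (y + z) = vdual t y + vdual t z" "mdual t (b + c) = mdual t b + mdual t c"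
    if "t \<in> tgr A d" for t d y z b c
    using linear_plus[OF dual_gr_linear[OF tgrD(3)[OF that]]] linear_plus[OF dual_gr_linear[OF tgrD(4)[OF that]]]
    by auto
  \<comment> \<open>In the terms with the functional of \<open>w\<close>, the right-hand side
    contains d1 d2 twice: once from exchanging \<open>u\<close> with the product of \<open>v\<close>
    and \<open>w\<close>, once from the left action of \<open>v\<close> on that functional.\<close>
  have parity: "ksg (d1 * d3 + (d2 * d3 + d1 * (d2 * 2))) z = ksg (d1 * d3 + d2 * d3) z" for z :: 'k
    by (rule ksg_cong) simp
  show ?thesis
    unfolding tform_homog[OF tprod_in[OF u v] w] tform_homog[OF u tprod_in[OF v w]]
    by (simp add: parity eval_pair_def tprod_def dual_ract_def ksg_add lin[OF u] lin[OF v] lin[OF w]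
        dual_lact_simps[OF v w] dual_lact_simps[OF w u] algebra_simps)
qed

end

section \<open>The cyclic form of a cochain\<close>

lemma multilinear_on_cong:
  assumes "\<And>xs. length xs = n \<Longrightarrow> set xs \<subseteq> U \<Longrightarrow> F xs = F' xs" "multilinear_on s U s' n F'"
    and U: "\<And>x y. x \<in> U \<Longrightarrow> y \<in> U \<Longrightarrow> x + y \<in> U" "\<And>r x. x \<in> U \<Longrightarrow> s r x \<in> U"
  shows "multilinear_on s U s' n F"
  unfolding multilinear_on_iff
proof (intro allI impI, elim conjE)
  fix xs i assume *: "length xs = n" "set xs \<subseteq> U" "i < n"
  have "F (xs[i := x]) = F' (xs[i := x])" if "x \<in> U" for x
    using * that set_update_subset_insert[of xs i x] by (intro assms(1)) auto
  then show "lin_on s U s' (\<lambda>x. F (xs[i := x]))"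
    by (rule lin_on_cong) (use multilinear_onD[OF assms(2) *] U in auto)
qed

lemma homog_snoc: "homog G (ds @ [d]) (xs @ [x]) \<longleftrightarrow> homog G ds xs \<and> x \<in> G d"
  using list_all2_rev[of "\<lambda>d x. x \<in> G d" "ds @ [d]" "xs @ [x]"] by auto

lemma homog_snocE:
  assumes "homog G ds xs" "length xs = Suc n"
  obtains es e ys y where "ds = es @ [e]" "xs = ys @ [y]" "homog G es ys" "y \<in> G e" "length ys = n"
proof -
  obtain ys y where xs: "xs = ys @ [y]" "length ys = n" using assms(2) by (auto simp: length_Suc_conv_rev)
  obtain es e where "ds = es @ [e]" using assms list_all2_lengthD[OF assms(1)]
    by (auto simp: length_Suc_conv_rev)
  then show ?thesis using that xs assms(1) by (simp add: homog_snoc)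
qed

lemma homog_rotate: "homog G ds xs \<Longrightarrow> homog G (rotate r ds) (rotate r xs)"
  using list_all2_lengthD[of _ ds xs] unfolding rotate_drop_take
  by (simp add: list_all2_appendI list_all2_dropI list_all2_takeI)

lemma rotate_add_length: "rotate (r + length xs) xs = rotate r xs"
  using rotate_conv_mod[of "r + length xs" xs] rotate_conv_mod[of r xs] by simp

lemma sum_list_rotate: "sum_list (rotate r xs) = sum_list (xs :: 'a::comm_monoid_add list)"
  unfolding rotate_drop_take
  by (metis add.commute append_take_drop_id sum_list.append)

lemma sdeg_append [simp]: "sdeg (xs @ ys) = sdeg xs + sdeg ys"
  by (simp add: sdeg_def)

lemma sdeg_Nil [simp]: "sdeg [] = 0"
  and sdeg_Cons [simp]: "sdeg (d # ds) = d - 1 + sdeg ds"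
  by (simp_all add: sdeg_def)

lemma sdeg_eq: "sdeg ds = sum_list ds - int (length ds)"
  by (induction ds) auto

text \<open>\<open>corner C\<close> is \<open>B (C (x\<^sub>1, \<dots>, x\<^sub>k), h\<^sub>k\<^sub>+\<^sub>1)\<close>; the sign comes from \<open>B (a, h) = - h (a)\<close>.\<close>

definition corner :: "('v list \<Rightarrow> 'm) \<Rightarrow> ('k::ring, 'v, 'm) tilde list \<Rightarrow> 'k" where
  "corner C vs = - mdual (last vs) (C (map fst (butlast vs)))"

definition rot_sum :: "('v list \<Rightarrow> 'm) \<Rightarrow> int list \<Rightarrow> ('k::ring, 'v, 'm) tilde list \<Rightarrow> 'k" where
  "rot_sum C ds vs =
     (\<Sum>r<length vs. ksg (sdeg (take r ds) * sdeg (drop r ds)) (corner C (rotate r vs)))"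

context graded_bimod
begin

section \<open>Cochains and their corner terms\<close>

lemma cochains_iff:
  "c \<in> cochains A k p \<longleftrightarrow> multilinear_on (vscale A) UNIV (mscale A) k c \<and>
     (\<forall>ds xs. homog (vgr A) ds xs \<and> length xs = k \<longrightarrow> c xs \<in> mgr A (sum_list ds + p))"
  by (auto simp: cochains_def list_all2_conv_all_nth)

lemma cochain_multilinear: "c \<in> cochains A k p \<Longrightarrow> multilinear_on (vscale A) UNIV (mscale A) k c"
  by (simp add: cochains_iff)

lemma cochain_in: "c \<in> cochains A k p \<Longrightarrow> homog (vgr A) ds xs \<Longrightarrow> length xs = k \<Longrightarrow> c xs \<in> mgr A (sum_list ds + p)"
  by (auto simp: cochains_iff)

lemma cochain_shift:
  assumes "c \<in> cochains A k p"
  shows "shift (vgr A) k c \<in> cochains A k p"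
  unfolding cochains_iff
  using V.multilinear_shift[OF M.vector_space_axioms cochain_multilinear[OF assms]]
    V.shift_multilinear_homog[OF cochain_multilinear[OF assms]] cochain_in[OF assms]
  by (auto simp: M.ksg_G)

lemma cochain_lin_comb:
  assumes "c \<in> cochains A k p" "c' \<in> cochains A k p"
  shows "(\<lambda>xs. mscale A r (c xs) + mscale A s (c' xs)) \<in> cochains A k p"
  unfolding cochains_iff
  using cochain_multilinear[OF assms(1)] cochain_multilinear[OF assms(2)]
    cochain_in[OF assms(1)] cochain_in[OF assms(2)]
  by (auto simp: multilinear_on_iff intro!: M.lin_on_add M.lin_on_scale M.add_G M.scale_G)

lemma homog_fst: "homog (tgr A) ds vs \<Longrightarrow> homog (vgr A) ds (map fst vs)"
  by (auto simp: list_all2_conv_all_nth tgr_def mem_Times_iff)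

lemma corner_snoc: "corner C (vs @ [v]) = - mdual v (C (map fst vs))"
  by (simp add: corner_def)

lemma corner_multilinear:
  assumes "multilinear_on (vscale A) UNIV (mscale A) k C"
  shows "multilinear_on (tscale A) (tcarrier A) (*) (Suc k) (corner C)"
  unfolding multilinear_on_iff
proof (intro allI impI, elim conjE)
  fix xs :: "('k, 'v, 'm) tilde list" and i
  assume *: "length xs = Suc k" "set xs \<subseteq> tcarrier A" "i < Suc k"
  then obtain vs v where xs: "xs = vs @ [v]" "length vs = k" by (auto simp: length_Suc_conv_rev)
  note v = tcarrierD(2)[of v]
  show "lin_on (tscale A) (tcarrier A) (*) (\<lambda>x. corner C (xs[i := x]))"
  proof (cases "i = k")
    case True
    have "lin_on (tscale A) (tcarrier A) (*) (\<lambda>x. - mdual x (C (map fst vs)))"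
      by (auto simp: lin_on_def tscale_def split_def)
    moreover have "xs[i := x] = vs @ [x]" for x using True xs by auto
    ultimately show ?thesis by (simp add: corner_snoc)
  next
    case False
    then have i: "i < k" using * by simp
    have l: "lin_on (vscale A) UNIV (mscale A) (\<lambda>x. C ((map fst vs)[i := x]))"
      by (rule multilinear_onD[OF assms]) (use i xs in auto)
    have "lin_on (tscale A) (tcarrier A) (mscale A) (\<lambda>x. C ((map fst vs)[i := fst x]))"
      using l by (auto simp: lin_on_def tscale_def split_def)
    then have "lin_on (tscale A) (tcarrier A) (*) (\<lambda>x. - mdual v (C ((map fst vs)[i := fst x])))"
      using * xs by (intro K.lin_on_uminus lin_on_comp[OF v]) auto
    then show ?thesis using i xs by (simp add: corner_snoc list_update_append1 map_update)
  qed
qed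

lemma corner_vanish:
  assumes C: "C \<in> cochains A k p" and "homog (tgr A) ds vs" "length vs = Suc k" "sum_list ds + p \<noteq> 0"
  shows "corner C vs = 0"
  using assms(2,3)
proof (rule homog_snocE)
  fix es e ys y
  assume *: "ds = es @ [e]" "vs = ys @ [y]" "homog (tgr A) es ys" "y \<in> tgr A e" "length ys = k"
  have "mdual y (C (map fst ys)) = 0"
    using dual_gr_vanish[OF tgrD(4)[OF *(4)] cochain_in[OF C homog_fst[OF *(3)]]] * assms(4)
    by (simp add: add_ac)
  then show ?thesis using * by (simp add: corner_snoc)
qed

lemma corner_rotate_vanish:
  assumes "C \<in> cochains A k p" "homog (tgr A) ds vs" "length vs = Suc k" "sum_list ds + p \<noteq> 0"
  shows "corner C (rotate r vs) = 0"
  using corner_vanish[OF assms(1) homog_rotate[OF assms(2)]] assms by (simp add: sum_list_rotate)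

lemma rot_sum_vanish:
  assumes "C \<in> cochains A k p" "homog (tgr A) ds vs" "length vs = Suc k" "sum_list ds + p \<noteq> 0"
  shows "rot_sum C ds vs = 0"
  by (simp add: rot_sum_def corner_rotate_vanish[OF assms])

lemma rot_sum_hml:
  assumes "C \<in> cochains A k p"
  shows "hml (tscale A) (tgr A) (*) (Suc k) (rot_sum C)"
proof -
  have "hml (tscale A) (tgr A) (*) (Suc k) (\<lambda>_ vs. corner C (rotate r vs))" for r
    by (intro T.hml_multilinear multilinear_on_rotate corner_multilinear cochain_multilinear[OF assms])
  then show ?thesis unfolding hml_def rot_sum_def length_list_update
    by (intro allI impI K.lin_on_sum K.lin_on_ksg) blast
qed

section \<open>Pairing the extended map with one more letter\<close>

definition tilde_val :: "('v list \<Rightarrow> 'm) \<Rightarrow> int list \<Rightarrow> ('k, 'v, 'm) tilde list \<Rightarrow> ('k, 'v, 'm) tilde" where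
  "tilde_val C ds vs = (0, C (map fst vs), (\<lambda>y. \<Sum>j<length vs. insert_dual A C ds vs j y), 0)"

text \<open>After j + 1 steps the letter \<open>vs ! j\<close> stands last, which is where
  \<open>corner\<close> reads the functional on M.\<close>

lemma rotate_Suc_snoc:
  assumes "j < length vs"
  shows "rotate (Suc j) (vs @ [v]) = (drop (Suc j) vs @ [v] @ take j vs) @ [vs ! j]"
  using assms by (simp add: rotate_drop_take take_Suc_conv_app_nth del: rotate_Suc)

text \<open>The functional inserted at place j, evaluated at a further letter, reads the word
  cyclically from place j + 1 on, so it is a rotated corner. Its sign is the Koszul sign of that
  rotation times (-1)^d; the latter factor and the minus sign of \<open>corner\<close> are absorbed
  by \<open>tB\<close> in \<open>tB_tilde_val\<close>.\<close>

lemma insert_dual_homog: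
  assumes C: "C \<in> cochains A k p" and h: "homog (tgr A) ds vs" "length vs = k" "j < k" and v: "v \<in> tgr A d"
  shows "insert_dual A C ds vs j (vpart v)
    = - ksg (d + sdeg (take (Suc j) (ds @ [d])) * sdeg (drop (Suc j) (ds @ [d])))
        (corner C (rotate (Suc j) (vs @ [v])))"
proof -
  have len: "length ds = k" using h list_all2_lengthD by blast
  have "vs ! j \<in> tgr A (ds ! j)" using h by (simp add: list_all2_conv_all_nth)
  then have lin: "Vector_Spaces.linear (mscale A) (*) (mdual (vs ! j))"
    by (rule dual_gr_linear[OF tgrD(4)])
  let ?us = "map fst (drop (Suc j) vs)" and ?ws = "map fst (take j vs)"
  have C0: "C (?us @ 0 # ?ws) = 0"
    by (rule V.multilinear_on_zero[OF cochain_multilinear[OF C]]) (use h in auto)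
  have "insert_dual A C ds vs j (vpart v)
    = ksg (d + sdeg (take (Suc j) ds) * sdeg (drop (Suc j) ds @ [d])) (mdual (vs ! j) (C (?us @ vpart v # ?ws)))"
    unfolding insert_dual_def Let_def using tgrD(1)[OF v]
    by (subst V.sum_homog0[where d = d and f = "\<lambda>i y. ksg (i + sdeg (take (Suc j) ds) * sdeg (drop (Suc j) ds @ [i]))
        (mdual (vs ! j) (C (?us @ [y] @ ?ws)))"]) (simp_all add: C0 linear_zero[OF lin])
  also have "mdual (vs ! j) (C (?us @ vpart v # ?ws)) = - corner C (rotate (Suc j) (vs @ [v]))"
    using h by (subst rotate_Suc_snoc) (simp_all add: corner_snoc del: append_assoc)
  finally show ?thesis using h len by (simp add: ksg_minus del: rotate_Suc)
qed

lemma insert_dual_linear: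
  assumes C: "C \<in> cochains A k p" and h: "homog (tgr A) ds vs" "length vs = k" "j < k"
  shows "Vector_Spaces.linear (vscale A) (*) (insert_dual A C ds vs j)"
proof -
  have "vs ! j \<in> tgr A (ds ! j)" using h by (simp add: list_all2_conv_all_nth)
  then have lin: "Vector_Spaces.linear (mscale A) (*) (mdual (vs ! j))"
    by (rule dual_gr_linear[OF tgrD(4)])
  let ?us = "map fst (drop (Suc j) vs)" and ?ws = "map fst (take j vs)"
  have slot: "lin_on (vscale A) UNIV (mscale A) (\<lambda>y. C (?us @ y # ?ws))"
    by (rule multilinear_on_slot[OF cochain_multilinear[OF C]]) (use h in auto)
  have "lin_on (vscale A) UNIV (mscale A) (\<lambda>y. C (?us @ hcomp (vgr A) i y # ?ws))" for i
    using slot V.lin_on_hcomp[of i] by (simp add: lin_on_def)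
  then have "lin_on (vscale A) UNIV (*) (insert_dual A C ds vs j)"
    unfolding insert_dual_def Let_def
    by (intro K.lin_on_sum K.lin_on_ksg lin_on_comp[OF lin]) simp
  then show ?thesis
    unfolding Vector_Spaces.linear_iff lin_on_def
    by (simp add: V.vector_space_axioms K.vector_space_axioms)
qed

lemma tilde_val_in:
  assumes C: "C \<in> cochains A k p" and h: "homog (tgr A) ds vs" "length vs = k"
  shows "tilde_val C ds vs \<in> tgr A (sum_list ds + p)"
proof -
  let ?g = "\<lambda>y. \<Sum>j<length vs. insert_dual A C ds vs j y"
  have "Vector_Spaces.linear (vscale A) (*) ?g"
    using insert_dual_linear[OF C h] h(2)
    unfolding Vector_Spaces.linear_iff
    by (simp add: sum.distrib sum_distrib_left V.vector_space_axioms K.vector_space_axioms)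
  moreover have "?g y = 0" if y: "y \<in> vgr A i" and i: "i \<noteq> - (sum_list ds + p)" for y i
  proof -
    \<comment> \<open>With \<open>y\<close> turned into a letter, the values of the inserted
      functionals at \<open>y\<close> become corners, and these vanish in the wrong degrees.\<close>
    have t: "(y, 0, 0, 0) \<in> tgr A i"
      using y T.zero_G[of i] M.zero_G by (simp add: tgr_def zero_prod_def)
    have "corner C (rotate r (vs @ [(y, 0, 0, 0)])) = 0" for r
      by (rule corner_rotate_vanish[OF C, of "ds @ [i]"]) (use h t i in \<open>simp_all add: homog_snoc\<close>)
    then show ?thesis
      using insert_dual_homog[OF C h _ t] h(2) by (intro sum.neutral) (simp del: rotate_Suc)
  qed
  ultimately show ?thesis
    using cochain_in[OF C homog_fst[OF h(1)]] h V.zero_G T.zero_G[of "sum_list ds + p"]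
    by (simp add: tilde_val_def tgr_def dual_gr_def zero_prod_def)
qed

text \<open>The unrotated corner comes from the M-component of \<open>tilde_val\<close> paired with
  the functional of \<open>v\<close>; the rotation by j + 1 steps comes from the functional inserted
  at place j. Off total degree zero both sides vanish, so the signs need to match only where the
  degree of \<open>v\<close> is opposite to that of \<open>tilde_val C ds vs\<close>.\<close>

lemma tB_tilde_val:
  assumes C: "C \<in> cochains A k p" and h: "homog (tgr A) ds vs" "length vs = k" and v: "v \<in> tgr A d"
  shows "tB A [tilde_val C ds vs, v] = rot_sum C (ds @ [d]) (vs @ [v])"
proof -
  let ?D = "sum_list ds + p"
  note t = tilde_val_in[OF C h]
  have hv: "homog (tgr A) (ds @ [d]) (vs @ [v])" using h v by (simp add: homog_snoc)
  show ?thesis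
  proof (cases "?D + d = 0")
    case False
    then show ?thesis
      using tform_vanish[OF t v] rot_sum_vanish[OF C hv] h
      by (simp add: tB_homog[OF t v] add_ac)
  next
    case True
    have "vdual v 0 = 0" using linear_zero[OF dual_gr_linear[OF tgrD(3)[OF v]]] .
    then have form: "tform A [tilde_val C ds vs, v]
        = (\<Sum>j<k. insert_dual A C ds vs j (vpart v)) - ksg (?D * d) (corner C (vs @ [v]))"
      using h unfolding tform_homog[OF t v] by (simp add: eval_pair_def tilde_val_def corner_snoc ksg_minus)
    \<comment> \<open>Both sign rules use D = -d: then D + D d = -d - d^2 is even, and D + d = 0, so
      in each case the -1 of the shift is what remains.\<close>
    have s0: "ksg (?D - 1 + ?D * d) x = - x" for x :: 'k
    proof -
      have "?D = - d" using True by simp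
      then show ?thesis by (simp add: ksg_def)
    qed
    have sj: "ksg (?D - 1 + (d + n)) x = - ksg n x" for x :: 'k and n
    proof (rule ksg_minus_cong)
      have "?D = - d" using True by simp
      then show "odd (?D - 1 + (d + n) + n)" by simp
    qed
    have "tB A [tilde_val C ds vs, v] = (\<Sum>j<k. ksg (?D - 1) (insert_dual A C ds vs j (vpart v)))
        - ksg (?D - 1 + ?D * d) (corner C (vs @ [v]))"
      unfolding tB_homog[OF t v] form by (simp add: ksg_diff ksg_sum)
    also have "\<dots> = corner C (vs @ [v]) + (\<Sum>j<k. ksg (?D - 1) (insert_dual A C ds vs j (vpart v)))"
      unfolding s0 by simp
    also have "(\<Sum>j<k. ksg (?D - 1) (insert_dual A C ds vs j (vpart v)))
        = (\<Sum>j<k. ksg (sdeg (take (Suc j) (ds @ [d])) * sdeg (drop (Suc j) (ds @ [d])))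
            (corner C (rotate (Suc j) (vs @ [v]))))"
    proof (intro sum.cong refl)
      fix j assume "j \<in> {..<k}"
      then have j: "j < k" by simp
      show "ksg (?D - 1) (insert_dual A C ds vs j (vpart v))
          = ksg (sdeg (take (Suc j) (ds @ [d])) * sdeg (drop (Suc j) (ds @ [d])))
            (corner C (rotate (Suc j) (vs @ [v])))"
        unfolding insert_dual_homog[OF C h j v] ksg_minus ksg_ksg sj by simp
    qed
    also have "corner C (vs @ [v]) + \<dots> = rot_sum C (ds @ [d]) (vs @ [v])"
      unfolding rot_sum_def length_append list.size h(2) add_0_right add_Suc_right
        sum.lessThan_Suc_shift[of _ k] take0 rotate0 by simp
    finally show ?thesis .
  qed
qed

text \<open>The first k letters are split by the \<open>kext\<close> inside
  \<open>tilde_map\<close>, the last one by linearity of \<open>tB\<close>. Together the two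
  splittings run over the degree lists of length k + 1.\<close>

lemma Omega_of_eq_kext:
  assumes c: "c \<in> cochains A k p" and vs: "length vs = Suc k" "set vs \<subseteq> tcarrier A"
  shows "Omega_of A k c vs = kext (tgr A) (rot_sum (shift (vgr A) k c)) vs"
proof -
  let ?C = "shift (vgr A) k c"
  note C = cochain_shift[OF c]
  obtain us u where u: "vs = us @ [u]" "length us = k" using vs(1) by (auto simp: length_Suc_conv_rev)
  have U: "set us \<subseteq> tcarrier A" "u \<in> tcarrier A" using u vs by auto
  let ?L = "{ds. length ds = k \<and> set ds \<subseteq> degs (tgr A)}"
  let ?us = "\<lambda>ds. map2 (hcomp (tgr A)) ds us"
  have h: "homog (tgr A) ds (?us ds)" "length (?us ds) = k" if "ds \<in> ?L" for ds
    using that u U by (auto intro: T.homog_hcomp)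
  have val: "tilde_val ?C ds (?us ds) \<in> tcarrier A" if "ds \<in> ?L" for ds
    using tilde_val_in[OF C h[OF that]] T.G_U by blast
  have tilde: "tilde_map A k ?C us = (\<Sum>ds\<in>?L. tilde_val ?C ds (?us ds))"
    unfolding tilde_map_def kext_def u(2) tilde_val_def using u(2) by (intro sum.cong) auto
  have lin1: "lin_on (tscale A) (tcarrier A) (*) (\<lambda>w. tB A [w, u])"
    using multilinear_on_slot[OF tB_multilinear, of "[]" "[u]"] U T.zero_U by simp
  have lin2: "lin_on (tscale A) (tcarrier A) (*) (\<lambda>u. tB A [w, u])" if "w \<in> tcarrier A" for w
    using multilinear_on_slot[OF tB_multilinear, of "[w]" "[]"] that T.zero_U by simp
  have "Omega_of A k c vs = tB A [\<Sum>ds\<in>?L. tilde_val ?C ds (?us ds), u]"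
    by (simp add: Omega_of_def Omega_def u tilde)
  also have "\<dots> = (\<Sum>ds\<in>?L. tB A [tilde_val ?C ds (?us ds), u])"
    by (rule T.lin_on_sum_arg[OF lin1 val])
  also have "\<dots> = (\<Sum>ds\<in>?L. tB A [tilde_val ?C ds (?us ds), \<Sum>d\<in>degs (tgr A). hcomp (tgr A) d u])"
    using U by (simp add: T.sum_hcomp)
  also have "\<dots> = (\<Sum>ds\<in>?L. \<Sum>d\<in>degs (tgr A). tB A [tilde_val ?C ds (?us ds), hcomp (tgr A) d u])"
    using U by (intro sum.cong refl T.lin_on_sum_arg[OF lin2 T.hcomp_U] val)
  also have "\<dots> = (\<Sum>ds\<in>?L. \<Sum>d\<in>degs (tgr A). rot_sum ?C (ds @ [d]) (?us ds @ [hcomp (tgr A) d u]))"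
    using U by (intro sum.cong refl tB_tilde_val[OF C h] T.hcomp_in)
  also have "\<dots> = kext (tgr A) (rot_sum ?C) vs"
    using u by (simp add: kext_def sum_lists_snoc)
  finally show ?thesis .
qed

lemma Omega_of_multilinear:
  assumes "c \<in> cochains A k p"
  shows "multilinear_on (tscale A) (tcarrier A) (*) (Suc k) (Omega_of A k c)"
  by (rule multilinear_on_cong[OF Omega_of_eq_kext[OF assms]])
    (auto intro: T.kext_multilinear K.vector_space_axioms rot_sum_hml cochain_shift[OF assms] T.add_U T.scale_U)

lemma Omega_of_homog:
  assumes "c \<in> cochains A k p" "homog (tgr A) ds vs" "length vs = Suc k"
  shows "Omega_of A k c vs = rot_sum (shift (vgr A) k c) ds vs"
  using Omega_of_eq_kext[OF assms(1,3) T.homog_set[OF assms(2)]]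
    T.kext_hml[OF rot_sum_hml[OF cochain_shift[OF assms(1)]] assms(2,3)] by simp

lemma Omega_of_vanish:
  assumes "c \<in> cochains A k p" "homog (tgr A) ds vs" "length vs = Suc k" "sum_list ds + p \<noteq> 0"
  shows "Omega_of A k c vs = 0"
  by (simp add: Omega_of_homog[OF assms(1-3)] rot_sum_vanish[OF cochain_shift[OF assms(1)] assms(2-4)])

lemma Omega_of_odd:
  assumes c: "c \<in> cochains A k (2 - int k)" and h: "homog (tgr A) ds vs" "length vs = Suc k"
  shows "Omega_of A k c vs = (\<Sum>r<Suc k. corner (shift (vgr A) k c) (rotate r vs))"
proof (cases "sum_list ds + (2 - int k) = 0")
  case False
  then show ?thesis
    using Omega_of_vanish[OF c h] corner_rotate_vanish[OF cochain_shift[OF c] h] by simp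
next
  case True
  \<comment> \<open>Here k + 1 letters have degrees of sum k - 2. An odd total forces one of any two
    complementary arcs to have even degree, so the product of their degrees is even.\<close>
  have "sdeg ds = - 3" using True h list_all2_lengthD[OF h(1)] by (simp add: sdeg_eq)
  have "even (sdeg (take r ds) * sdeg (drop r ds))" for r
  proof -
    have "sdeg (take r ds) + sdeg (drop r ds) = - 3"
      using \<open>sdeg ds = - 3\<close> sdeg_append[of "take r ds" "drop r ds"] by simp
    then have "odd (sdeg (take r ds) + sdeg (drop r ds))" by simp
    then show ?thesis by simp
  qed
  then show ?thesis using h by (simp add: Omega_of_homog[OF c h] rot_sum_def ksg_def)
qed

lemma Omega_of_cyclic:
  assumes c: "c \<in> cochains A k (2 - int k)"
  shows "Omega_of A k c \<in> cyclic_forms A (k + 1)"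
proof -
  have "Omega_of A k c (last vs # butlast vs) = ksg (sdeg [last ds] * sdeg (butlast ds)) (Omega_of A k c vs)"
    if dv: "length ds = k + 1" "length vs = k + 1" "\<forall>i<k + 1. vs ! i \<in> tgr A (ds ! i)" for ds vs
  proof -
    have h: "homog (tgr A) ds vs" "length vs = Suc k" using dv by (auto simp: list_all2_conv_all_nth)
    let ?f = "\<lambda>r. corner (shift (vgr A) k c) (rotate r vs)"
    have rot: "last xs # butlast xs = rotate k xs" if l: "length xs = Suc k" for xs :: "('k, 'v, 'm) tilde list"
    proof -
      obtain ys y where "xs = ys @ [y]" "length ys = k" using l by (auto simp: length_Suc_conv_rev)
      then show ?thesis by (simp add: rotate_drop_take)
    qed
    have per: "?f (r + Suc k) = ?f r" for r
      using rotate_add_length[of r vs] h(2) by simp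
    have "Omega_of A k c (rotate k vs) = (\<Sum>r<Suc k. ?f (r + k))"
      using Omega_of_odd[OF c homog_rotate[OF h(1)], of k] h(2) by (simp add: rotate_rotate)
    also have "\<dots> = Omega_of A k c vs"
      unfolding Omega_of_odd[OF c h] by (rule sum_periodic_shift[of ?f "Suc k" k, OF per])
    finally have eq: "Omega_of A k c (last vs # butlast vs) = Omega_of A k c vs" using rot h by simp
    \<comment> \<open>Rotation invariance has been shown without a sign. The sign that
      \<open>cyclic_forms\<close> asks for is trivial when the total shifted degree is -3, and
      otherwise both values are 0.\<close>
    show ?thesis
    proof (cases "sum_list ds + (2 - int k) = 0")
      case False
      then show ?thesis using eq Omega_of_vanish[OF c h] by simp
    next
      case True
      have "sdeg ds = - 3" using True h list_all2_lengthD[OF h(1)] by (simp add: sdeg_eq)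
      moreover obtain es e where "ds = es @ [e]" using dv(1) by (auto simp: length_Suc_conv_rev)
      ultimately have sum: "sdeg [last ds] + sdeg (butlast ds) = - 3" by simp
      have "odd (sdeg [last ds] + sdeg (butlast ds))" unfolding sum by simp
      then have "even (sdeg [last ds] * sdeg (butlast ds))" by simp
      then show ?thesis using eq by (simp add: ksg_def)
    qed
  qed
  then show ?thesis using Omega_of_multilinear[OF c] by (simp add: cyclic_forms_def)
qed

lemma Omega_of_lin_comb:
  assumes c: "c \<in> cochains A k p" "c' \<in> cochains A k p" and vs: "length vs = Suc k" "set vs \<subseteq> tcarrier A"
  shows "Omega_of A k (\<lambda>xs. mscale A r (c xs) + mscale A s (c' xs)) vs
    = r * Omega_of A k c vs + s * Omega_of A k c' vs"
proof (rule T.multilinear_ext[OF _ _ K.vector_space_axioms vs])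
  let ?c = "\<lambda>xs. mscale A r (c xs) + mscale A s (c' xs)"
  note lc = cochain_lin_comb[OF c, of r s]
  show "multilinear_on (tscale A) (tcarrier A) (*) (Suc k) (Omega_of A k ?c)"
    by (rule Omega_of_multilinear[OF lc])
  show "multilinear_on (tscale A) (tcarrier A) (*) (Suc k) (\<lambda>vs. r * Omega_of A k c vs + s * Omega_of A k c' vs)"
    using Omega_of_multilinear[OF c(1)] Omega_of_multilinear[OF c(2)]
    unfolding multilinear_on_iff by (intro allI impI K.lin_on_add K.lin_on_scale) blast+
  fix ds ws assume h: "homog (tgr A) ds ws" "length ws = Suc k"
  have shift: "shift (vgr A) k ?c xs = mscale A r (shift (vgr A) k c xs) + mscale A s (shift (vgr A) k c' xs)" for xs
    unfolding shift_def kext_def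
    by (simp add: ksg_add M.scale_ksg sum.distrib M.scale_sum_right)
  have lin: "corner (shift (vgr A) k ?c) us
    = r * corner (shift (vgr A) k c) us + s * corner (shift (vgr A) k c') us"
    if "us \<noteq> []" "set us \<subseteq> tcarrier A" for us
  proof -
    have "Vector_Spaces.linear (mscale A) (*) (mdual (last us))" using that by (intro tcarrierD) auto
    then show ?thesis unfolding corner_def shift
      by (simp add: linear_plus linear_scale' algebra_simps)
  qed
  have corner: "corner (shift (vgr A) k ?c) (rotate n ws)
    = r * corner (shift (vgr A) k c) (rotate n ws) + s * corner (shift (vgr A) k c') (rotate n ws)" for n
    by (rule lin) (use h(2) T.homog_set[OF h(1)] in auto)
  show "Omega_of A k ?c ws = r * Omega_of A k c ws + s * Omega_of A k c' ws"
    unfolding Omega_of_homog[OF lc h] Omega_of_homog[OF c(1) h] Omega_of_homog[OF c(2) h] rot_sum_def corner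
    by (simp add: ksg_add sum.distrib sum_distrib_left ksg_mult_right)
qed

end

section \<open>The Pinczon bracket with the product\<close>

context graded_bimod
begin

definition insertQ :: "nat \<Rightarrow> ('k, 'v, 'm) tilde list \<Rightarrow> ('k, 'v, 'm) tilde list" where
  "insertQ j us = take j us @ tQ A [us ! j, us ! Suc j] # drop (j + 2) us"

lemma insertQ_append: "length ws = j \<Longrightarrow> insertQ j (ws @ u # u' # us) = ws @ tQ A [u, u'] # us"
  by (simp add: insertQ_def nth_append)

lemma split_at_pair:
  assumes "length us = k + 2" "j \<le> k"
  obtains ws u u' ws' where "us = ws @ u # u' # ws'" "length ws = j" "length ws' = k - j"
proof -
  have "drop j us = us ! j # us ! Suc j # drop (j + 2) us"
    using assms by (simp add: Cons_nth_drop_Suc)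
  then have "us = take j us @ us ! j # us ! Suc j # drop (j + 2) us"
    by (metis append_take_drop_id)
  then show ?thesis by (rule that) (use assms in simp_all)
qed

text \<open>Contracting at place j is contracting at the front of a rotated word and rotating on.
  The contraction leaves k + 1 letters, so k + 1 - j further steps, not k + 2 - j, close the
  circle.\<close>

lemma insertQ_rotate:
  assumes "length us = k + 2" "j \<le> k"
  shows "insertQ j us = rotate (k + 1 - j) (insertQ 0 (rotate j us))"
  using assms
proof (rule split_at_pair)
  fix ws u u' ws'
  assume us: "us = ws @ u # u' # ws'" and l: "length ws = j" "length ws' = k - j"
  have "rotate j us = [] @ u # u' # ws' @ ws"
    using us rotate_append[of ws "u # u' # ws'"] l by simp
  then have "insertQ 0 (rotate j us) = (tQ A [u, u'] # ws') @ ws"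
    using insertQ_append[of "[]" 0 u u' "ws' @ ws"] by simp
  then have "rotate (k + 1 - j) (insertQ 0 (rotate j us)) = ws @ tQ A [u, u'] # ws'"
    using rotate_append[of "tQ A [u, u'] # ws'" ws] l assms by (simp add: Suc_diff_le)
  then show ?thesis using insertQ_append[OF l(1)] us by simp
qed

text \<open>Invariance moves the product to the last two letters, which frees the first slot for a
  basis vector. The shifts give the exponent (d1 + d2 - 1) + (d1 - 1) on the left and d2 - 1 on the
  right; they have opposite parities, hence the minus sign.\<close>

lemma Omega_tQ:
  assumes u: "u \<in> tgr A d1" and v: "v \<in> tgr A d2" and w: "w \<in> tgr A d3"
  shows "Omega A (tQ A) [u, v, w] = - tform A [u, tQ A [v, w]]"
proof -
  note U = T.G_U[OF u] T.G_U[OF w] T.G_U[OF tprod_in[OF u v]] T.G_U[OF tprod_in[OF v w]]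
  have "Omega A (tQ A) [u, v, w] = ksg (d1 + d2 - 1) (tform A [tQ A [u, v], w])"
    using tB_homog[OF tQ_in[OF u v] w] by (simp add: Omega_def)
  also have "\<dots> = ksg (d1 + d2 - 1 + (d1 - 1)) (tform A [u, tprod d2 d3 v w])"
    using U by (simp add: tQ_homog[OF u v] tform_ksg tform_invariant[OF u v w])
  also have "\<dots> = - ksg (d2 - 1) (tform A [u, tprod d2 d3 v w])"
    by (rule ksg_minus_cong) simp
  also have "\<dots> = - tform A [u, tQ A [v, w]]"
    using U by (simp add: tQ_homog[OF v w] tform_ksg)
  finally show ?thesis .
qed

text \<open>Pairing with \<open>e i\<close> reads off the coefficient of \<open>u\<close> at
  \<open>e' i\<close>.\<close>

lemma dual_basis_expand:
  assumes bases: "dual_bases A N e e'" and u: "u \<in> tcarrier A"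
  shows "(\<Sum>i<N. tscale A (tform A [e i, u]) (e' i)) = u"
proof -
  have inj: "inj_on e' {..<N}" and span: "T.span (e' ` {..<N}) = tcarrier A"
    and dual: "\<And>i j. i < N \<Longrightarrow> j < N \<Longrightarrow> tform A [e i, e' j] = (if i = j then 1 else 0)"
    and e: "\<And>i. i < N \<Longrightarrow> e i \<in> tcarrier A" and e': "\<And>i. i < N \<Longrightarrow> e' i \<in> tcarrier A"
    using bases T.G_U unfolding dual_bases_def homogeneous_basis_def by blast+
  obtain a where "u = (\<Sum>b\<in>e' ` {..<N}. tscale A (a b) b)"
    using u span T.span_finite[of "e' ` {..<N}"] by auto
  then have u_eq: "u = (\<Sum>j<N. tscale A (a (e' j)) (e' j))"
    by (simp add: sum.reindex[OF inj])
  have "tform A [e i, u] = a (e' i)" if i: "i < N" for i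
  proof -
    note lin = tform_lin(2)[OF e[OF i]]
    have "tform A [e i, u] = (\<Sum>j<N. tform A [e i, tscale A (a (e' j)) (e' j)])"
      unfolding u_eq by (rule T.lin_on_sum_arg[OF lin]) (auto intro: T.scale_U e')
    also have "\<dots> = (\<Sum>j<N. a (e' j) * tform A [e i, e' j])"
      using lin e' unfolding lin_on_def by (intro sum.cong) auto
    also have "\<dots> = (\<Sum>j<N. if i = j then a (e' j) else 0)"
      using i by (intro sum.cong) (auto simp: dual)
    also have "\<dots> = a (e' i)" using i by simp
    finally show ?thesis .
  qed
  then show ?thesis using u_eq by simp
qed

text \<open>The basis sum inside the bracket, for the form of \<open>tQ\<close> in three variables
  and a second form of degree 3; the number 2 is \<open>n - 1\<close> for n = 3. By
  \<open>Omega_tQ\<close> each first factor is minus a pairing of \<open>e i\<close> with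
  \<open>tQ\<close> of the two leading letters. The Koszul sign cancels this minus, and the dual
  basis expansion reassembles the argument of \<open>\<Omega>\<close>.\<close>

lemma pinczon_contraction:
  assumes bases: "dual_bases A N e e'"
    and \<Omega>: "multilinear_on (tscale A) (tcarrier A) (*) (Suc k) \<Omega>"
    and h: "homog (tgr A) ds vs" "length vs = k + 2"
  shows "(\<Sum>i<N. kext (tgr A)
       (\<lambda>ds us.
          let \<epsilon> = sdeg [ds ! 0]; \<epsilon>' = sdeg [ds ! 1]; P = sdeg (take 2 (drop 2 ds))
          in ksg (3 * (\<epsilon> + P) + \<epsilon>' * P)
               (Omega A (tQ A) (us ! 0 # take 2 (drop 2 us)) * \<Omega> (us ! 1 # drop 2 (drop 2 us))))
       (e i # e' i # vs)) = \<Omega> (insertQ 0 vs)"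
proof -
  obtain v w rest where vs: "vs = v # w # rest" "length rest = k"
    using h(2) by (auto simp: numeral_2_eq_2 length_Suc_conv)
  obtain d1 d2 es where ds: "ds = d1 # d2 # es" and v: "v \<in> tgr A d1" and w: "w \<in> tgr A d2"
    and rest: "homog (tgr A) es rest"
    using h(1) by (auto simp: vs list_all2_Cons2)
  let ?Q = "tQ A [v, w]"
  let ?\<Phi> = "\<lambda>ds us.
          let \<epsilon> = sdeg [ds ! 0]; \<epsilon>' = sdeg [ds ! 1]; P = sdeg (take 2 (drop 2 ds))
          in ksg (3 * (\<epsilon> + P) + \<epsilon>' * P)
               (Omega A (tQ A) (us ! 0 # take 2 (drop 2 us)) * \<Omega> (us ! 1 # drop 2 (drop 2 us)))"
  have Q: "?Q \<in> tcarrier A" using tQ_in[OF v w] T.G_U by blast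
  have restU: "set rest \<subseteq> tcarrier A" by (rule T.homog_set[OF rest])
  have summand: "kext (tgr A) ?\<Phi> (e i # e' i # vs) = tform A [e i, ?Q] * \<Omega> (e' i # rest)" if i: "i < N" for i
  proof -
    have "\<exists>d. e i \<in> tgr A d" "\<exists>d. e' i \<in> tgr A d" and one: "tform A [e i, e' i] = 1"
      using bases i unfolding dual_bases_def homogeneous_basis_def by simp_all
    then obtain d d' where e: "e i \<in> tgr A d" and e': "e' i \<in> tgr A d'" by blast
    have dd: "d' = - d" using tform_vanish[OF e e'] one by (cases "d + d' = 0") auto
    have "kext (tgr A) ?\<Phi> (e i # e' i # vs) = ?\<Phi> (d # d' # ds) (e i # e' i # vs)"
    proof (rule T.kext_homog)
      show "homog (tgr A) (d # d' # ds) (e i # e' i # vs)" using e e' h by simp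
      fix ds' us assume hu: "homog (tgr A) ds' us" "length us = length (e i # e' i # vs)" and z: "0 \<in> set us"
      obtain a b c x r where us: "us = a # b # c # x # r" "length r = k"
        using hu(2) vs by (auto simp: length_Suc_conv)
      obtain da db dc dx where a: "a \<in> tgr A da" and b: "b \<in> tgr A db" and c: "c \<in> tgr A dc"
        and x: "x \<in> tgr A dx" and r: "set r \<subseteq> tcarrier A"
        using hu(1) by (auto simp: us list_all2_Cons2 dest: T.homog_set)
      \<comment> \<open>A zero letter is an argument of one of the two factors; if it is not one of
        \<open>\<Omega>\<close>, it makes the pairing in \<open>Omega_tQ\<close> vanish.\<close>
      have "Omega A (tQ A) [a, c, x] * \<Omega> (b # r) = 0"
      proof (cases "0 \<in> set (b # r)")
        case True
        have "\<Omega> (b # r) = 0"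
          by (rule T.multilinear_on_zero[OF \<Omega> _ _ True]) (use us b r T.G_U in auto)
        then show ?thesis by simp
      next
        case False
        then have "a = 0 \<or> tQ A [c, x] = 0"
          using z us tprod_homog_zero[of dc dx c x] c x by (auto simp: tQ_homog[OF c x])
        then have "tform A [a, tQ A [c, x]] = 0"
          using T.lin_on_zero_arg[OF tform_lin(1)[OF T.G_U[OF tQ_in[OF c x]]]]
            T.lin_on_zero_arg[OF tform_lin(2)[OF T.G_U[OF a]]] by auto
        then show ?thesis by (simp add: Omega_tQ[OF a c x])
      qed
      then show "?\<Phi> ds' us = 0" by (simp add: us Let_def numeral_2_eq_2)
    qed
    also have "\<dots> = ksg (3 * (d - 1 + (d1 - 1 + (d2 - 1))) + (d' - 1) * (d1 - 1 + (d2 - 1)))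
        (- tform A [e i, ?Q] * \<Omega> (e' i # rest))"
      by (simp add: vs ds Let_def numeral_2_eq_2 Omega_tQ[OF e v w])
    also have "\<dots> = tform A [e i, ?Q] * \<Omega> (e' i # rest)"
    proof (cases "d + (d1 + d2) = 0")
      case False
      then show ?thesis using tform_vanish[OF e tQ_in[OF v w]] by simp
    next
      case True
      \<comment> \<open>With d1 + d2 = -d and d' = -d the exponent equals -9 + (d + 1)(d + 2), which
        is odd.\<close>
      then have "d2 = - d - d1" by simp
      then have "odd (3 * (d - 1 + (d1 - 1 + (d2 - 1))) + (d' - 1) * (d1 - 1 + (d2 - 1)) + 0)"
        by (simp add: dd)
      from ksg_minus_cong[OF this] show ?thesis by (rule trans) simp
    qed
    finally show ?thesis .
  qed
  have e'U: "e' i \<in> tcarrier A" if "i < N" for i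
    using bases that T.G_U unfolding dual_bases_def homogeneous_basis_def by blast
  have lin: "lin_on (tscale A) (tcarrier A) (*) (\<lambda>u. \<Omega> (u # rest))"
    using multilinear_on_slot[OF \<Omega>, of "[]" rest] restU T.zero_U vs by simp
  have "(\<Sum>i<N. kext (tgr A) ?\<Phi> (e i # e' i # vs)) = (\<Sum>i<N. tform A [e i, ?Q] * \<Omega> (e' i # rest))"
    by (intro sum.cong refl summand) simp
  also have "\<dots> = (\<Sum>i<N. \<Omega> (tscale A (tform A [e i, ?Q]) (e' i) # rest))"
    using lin e'U unfolding lin_on_def by (intro sum.cong) auto
  also have "\<dots> = \<Omega> ((\<Sum>i<N. tscale A (tform A [e i, ?Q]) (e' i)) # rest)"
    by (rule T.lin_on_sum_arg[OF lin, symmetric]) (auto intro: T.scale_U e'U)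
  also have "\<dots> = \<Omega> (insertQ 0 vs)"
    unfolding dual_basis_expand[OF bases Q] by (simp add: insertQ_def vs)
  finally show ?thesis .
qed

lemma pinczon_d_eq_kext:
  assumes bases: "dual_bases A N e e'"
    and \<Omega>: "multilinear_on (tscale A) (tcarrier A) (*) (Suc k) \<Omega>"
    and vs: "length vs = k + 2" "set vs \<subseteq> tcarrier A"
  shows "pinczon_d A N e e' (k + 1) 3 \<Omega> vs = kext (tgr A)
    (\<lambda>ds us. \<Sum>r<k + 2. ksg (sdeg (take r ds) * sdeg (drop r ds)) (\<Omega> (insertQ 0 (rotate r us)))) vs"
  unfolding pinczon_d_def pinczon_def cycl_def
proof (rule T.kext_cong[OF vs(2)], goal_cases)
  case (1 ds us)
  have n: "3 + (k + 1) - 2 = k + 2" "3 - 1 = (2::nat)" by simp_all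
  show ?case unfolding n
  proof (intro sum.cong refl arg_cong2[of _ _ _ _ ksg])
    fix r assume r: "r \<in> {..<k + 2}"
    then have rot: "drop r us @ take r us = rotate r us" using 1 vs by (simp add: rotate_drop_take)
    show "(\<Sum>i<N. kext (tgr A)
       (\<lambda>ds us.
          let \<epsilon> = sdeg [ds ! 0]; \<epsilon>' = sdeg [ds ! 1]; P = sdeg (take 2 (drop 2 ds))
          in ksg (3 * (\<epsilon> + P) + \<epsilon>' * P)
               (Omega A (tQ A) (us ! 0 # take 2 (drop 2 us)) * \<Omega> (us ! 1 # drop 2 (drop 2 us))))
       (e i # e' i # drop r us @ take r us)) = \<Omega> (insertQ 0 (rotate r us))"
      unfolding rot using 1 vs by (intro pinczon_contraction[OF bases \<Omega> homog_rotate]) simp_all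
  qed
qed

end

section \<open>The Hochschild differential on shifted cochains\<close>

context graded_bimod
begin

text \<open>The integrand of \<open>hoch_shifted\<close> with its signs collected. The first
  exponent is the shifted degree of C(x_1, ..., x_k), the shift sign of Q_W. The second joins the
  passage of C past x_1 with the shift sign of Q_W. The third joins the passage of Q past C and the
  preceding letters with the shift sign of Q, which extends the prefix by one letter.\<close>

definition hoch_val :: "nat \<Rightarrow> int \<Rightarrow> ('v list \<Rightarrow> 'm) \<Rightarrow> int list \<Rightarrow> 'v list \<Rightarrow> 'm" where
  "hoch_val k w C ds xs =
     ksg (w + sdeg (take k ds)) (ract A (C (take k xs)) (xs ! k))
     + ksg ((w + 1) * (ds ! 0 - 1)) (lact A (xs ! 0) (C (drop 1 xs)))
     - (\<Sum>j<k. ksg (w + sdeg (take (Suc j) ds)) (C (take j xs @ vmul A (xs ! j) (xs ! Suc j) # drop (j + 2) xs)))"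

lemma shift_vmul_homog:
  assumes "x \<in> vgr A d" "y \<in> vgr A d'"
  shows "shift (vgr A) 2 (\<lambda>xs. vmul A (xs ! 0) (xs ! 1)) [x, y] = ksg (d - 1) (vmul A x y)"
proof -
  have "shift (vgr A) 2 (\<lambda>xs. vmul A (xs ! 0) (xs ! 1)) [x, y]
    = ksg (\<Sum>j<2. (int 2 - 1 - int j) * ([d, d'] ! j - 1)) (vmul A ([x, y] ! 0) ([x, y] ! 1))"
  proof (rule V.shift_homog)
    fix ds' xs' assume "homog (vgr A) ds' xs'" "length xs' = 2" "0 \<in> set xs'"
    then show "vmul A (xs' ! 0) (xs' ! 1) = 0" by (elim homog_2) auto
  qed (use assms in auto)
  then show ?thesis by (simp add: sum_lessThan_2)
qed

lemma shift_wmul_homog: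
  assumes "u \<in> wgr A d" "w \<in> wgr A d'"
  shows "shift (wgr A) 2 (\<lambda>ws. wmul A (ws ! 0) (ws ! 1)) [u, w] = ksg (d - 1) (wmul A u w)"
proof -
  have "shift (wgr A) 2 (\<lambda>xs. wmul A (xs ! 0) (xs ! 1)) [u, w]
    = ksg (\<Sum>j<2. (int 2 - 1 - int j) * ([d, d'] ! j - 1)) (wmul A ([u, w] ! 0) ([u, w] ! 1))"
  proof (rule W.shift_homog)
    fix ds' xs' assume "homog (wgr A) ds' xs'" "length xs' = 2" "0 \<in> set xs'"
    then show "wmul A (xs' ! 0) (xs' ! 1) = 0"
      by (elim homog_2) (auto simp: wmul_def split_def zero_prod_def)
  qed (use assms in auto)
  then show ?thesis by (simp add: sum_lessThan_2)
qed

lemma cochain_ksg_slot: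
  assumes "multilinear_on (vscale A) UNIV (mscale A) k C" "length us + length ws + 1 = k"
  shows "C (us @ ksg n x # ws) = ksg n (C (us @ x # ws))"
proof -
  have "lin_on (vscale A) UNIV (mscale A) (\<lambda>x. C (us @ x # ws))"
    by (rule multilinear_on_slot[OF assms(1)]) (use assms(2) in auto)
  then have "C (us @ vscale A (- 1) x # ws) = mscale A (- 1) (C (us @ x # ws))"
    unfolding lin_on_def by blast
  then show ?thesis by (simp add: ksg_def)
qed

lemma homog_take: "homog G ds xs \<Longrightarrow> homog G (take n ds) (take n xs)"
  by (rule list_all2_takeI)

lemma homog_drop: "homog G ds xs \<Longrightarrow> homog G (drop n ds) (drop n xs)"
  by (rule list_all2_dropI)

lemma homog_nth: "homog G ds xs \<Longrightarrow> i < length xs \<Longrightarrow> xs ! i \<in> G (ds ! i)"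
  by (simp add: list_all2_conv_all_nth)

lemma hoch_shifted_eq_kext:
  assumes C: "C \<in> cochains A k p"
  shows "length xs = Suc k \<Longrightarrow> hoch_shifted A k (p + int k - 1) C xs = kext (vgr A) (hoch_val k (p + int k - 1) C) xs"
  unfolding hoch_shifted_def Let_def
proof (rule V.kext_cong, goal_cases)
  case (2 ds ys)
  let ?w = "p + int k - 1"
  have h: "homog (vgr A) ds ys" and l: "length ys = Suc k" using 2 by auto
  note l = l list_all2_lengthD[OF h, unfolded l]
  have CL: "C (take k ys) \<in> mgr A (sum_list (take k ds) + p)"
    by (rule cochain_in[OF C homog_take[OF h]]) (use l in simp)
  have CR: "C (drop 1 ys) \<in> mgr A (sum_list (drop 1 ds) + p)"
    by (rule cochain_in[OF C homog_drop[OF h]]) (use l in simp)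
  have e1: "snd (shift (wgr A) 2 (\<lambda>ws. wmul A (ws ! 0) (ws ! 1)) [(0, C (take k ys)), (ys ! k, 0)])
      = ksg (?w + sdeg (take k ds)) (ract A (C (take k ys)) (ys ! k))"
    using shift_wmul_homog[of "(0, C (take k ys))" "sum_list (take k ds) + p" "(ys ! k, 0)" "ds ! k"]
      CL homog_nth[OF h, of k] l V.zero_G M.zero_G
    by (simp add: wgr_def wmul_def sdeg_eq algebra_simps)
  have e2: "snd (shift (wgr A) 2 (\<lambda>ws. wmul A (ws ! 0) (ws ! 1)) [(ys ! 0, 0), (0, C (drop 1 ys))])
      = ksg (ds ! 0 - 1) (lact A (ys ! 0) (C (drop 1 ys)))"
    using shift_wmul_homog[of "(ys ! 0, 0)" "ds ! 0" "(0, C (drop 1 ys))" "sum_list (drop 1 ds) + p"]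
      CR homog_nth[OF h, of 0] l V.zero_G M.zero_G
    by (simp add: wgr_def wmul_def)
  have e3: "ksg (?w + sdeg (take j ds))
        (C (take j ys @ [shift (vgr A) 2 (\<lambda>xs. vmul A (xs ! 0) (xs ! 1)) [ys ! j, ys ! Suc j]] @ drop (j + 2) ys))
      = ksg (?w + sdeg (take (Suc j) ds)) (C (take j ys @ vmul A (ys ! j) (ys ! Suc j) # drop (j + 2) ys))"
    if "j < k" for j
    using that l shift_vmul_homog[OF homog_nth[OF h, of j] homog_nth[OF h, of "Suc j"]]
    by (simp add: cochain_ksg_slot[OF cochain_multilinear[OF C]] take_Suc_conv_app_nth add_ac)
  have e4: "sdeg (take 1 ds) = ds ! 0 - 1" using l by (cases ds) auto
  have e5: "ksg (?w * (ds ! 0 - 1)) (ksg (ds ! 0 - 1) x) = ksg ((?w + 1) * (ds ! 0 - 1)) x" for x :: 'm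
    by (simp add: algebra_simps)
  show ?case
    unfolding e1 e2 e4 e5 hoch_val_def using e3 by simp
qed auto

lemma hoch_val_in:
  assumes C: "C \<in> cochains A k p" and h: "homog (vgr A) ds xs" "length xs = Suc k"
  shows "hoch_val k w C ds xs \<in> mgr A (sum_list ds + p)"
proof -
  have l: "length ds = Suc k" using h list_all2_lengthD by fastforce
  have "ract A (C (take k xs)) (xs ! k) \<in> mgr A (sum_list (take k ds) + p + ds ! k)"
    by (intro act_in cochain_in[OF C] homog_take homog_nth h) (use h in simp_all)
  moreover have "sum_list (take k ds) + p + ds ! k = sum_list ds + p"
  proof -
    obtain es e where "ds = es @ [e]" "length es = k" using l by (auto simp: length_Suc_conv_rev)
    then show ?thesis by (simp add: nth_append)
  qed
  ultimately have 1: "ract A (C (take k xs)) (xs ! k) \<in> mgr A (sum_list ds + p)" by simp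
  have "lact A (xs ! 0) (C (drop 1 xs)) \<in> mgr A (ds ! 0 + (sum_list (drop 1 ds) + p))"
    by (intro act_in cochain_in[OF C] homog_drop homog_nth h) (use h in simp_all)
  moreover have "ds ! 0 + (sum_list (drop 1 ds) + p) = sum_list ds + p"
    using l by (cases ds) auto
  ultimately have 2: "lact A (xs ! 0) (C (drop 1 xs)) \<in> mgr A (sum_list ds + p)" by (simp only:)
  have 3: "C (take j xs @ vmul A (xs ! j) (xs ! Suc j) # drop (j + 2) xs) \<in> mgr A (sum_list ds + p)"
    if j: "j < k" for j
  proof -
    have "C (take j xs @ vmul A (xs ! j) (xs ! Suc j) # drop (j + 2) xs)
        \<in> mgr A (sum_list (take j ds @ (ds ! j + ds ! Suc j) # drop (j + 2) ds) + p)"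
      using h j by (intro cochain_in[OF C] list_all2_appendI homog_take list_all2_Cons[THEN iffD2] conjI
          homog_drop act_in homog_nth) auto
    moreover have "ds = take j ds @ ds ! j # ds ! Suc j # drop (j + 2) ds"
      using j l by (simp add: Cons_nth_drop_Suc)
    then have "sum_list ds = sum_list (take j ds @ ds ! j # ds ! Suc j # drop (j + 2) ds)" by simp
    ultimately show ?thesis by (simp add: add_ac)
  qed
  have "M.subspace (mgr A (sum_list ds + p))" by (rule M.subspace_G)
  then show ?thesis unfolding hoch_val_def
    by (intro M.subspace_diff M.add_G M.ksg_G M.sum_G) (use 1 2 3 in simp_all)
qed

lemma hoch_val_hml:
  assumes C: "C \<in> cochains A k p"
  shows "hml (vscale A) (vgr A) (mscale A) (Suc k) (hoch_val k w C)"
proof -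
  note ml = cochain_multilinear[OF C]
  have lin_id: "lin_on (vscale A) UNIV (vscale A) (\<lambda>x. x)" by (simp add: lin_on_def)
  have 1: "multilinear_on (vscale A) UNIV (mscale A) (Suc k) (\<lambda>xs. ract A (C (take k xs)) (xs ! k))"
    unfolding multilinear_on_iff
  proof (intro allI impI, elim conjE)
    fix xs :: "'v list" and i assume l: "length xs = Suc k" "i < Suc k"
    show "lin_on (vscale A) UNIV (mscale A) (\<lambda>x. ract A (C (take k (xs[i := x]))) (xs[i := x] ! k))"
    proof (cases "i = k")
      case True
      then show ?thesis
        using l lin_on_comp[OF graded_bilinearD(1)[OF ract_bilinear] lin_id] by simp
    next
      case False
      then have "lin_on (vscale A) UNIV (mscale A) (\<lambda>x. C ((take k xs)[i := x]))"
        using l by (intro multilinear_onD[OF ml]) auto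
      then show ?thesis
        using l False lin_on_comp[OF graded_bilinearD(2)[OF ract_bilinear]] by (simp add: take_update_swap)
    qed
  qed
  have 2: "multilinear_on (vscale A) UNIV (mscale A) (Suc k) (\<lambda>xs. lact A (xs ! 0) (C (drop 1 xs)))"
    unfolding multilinear_on_iff
  proof (intro allI impI, elim conjE)
    fix xs :: "'v list" and i assume l: "length xs = Suc k" "i < Suc k"
    show "lin_on (vscale A) UNIV (mscale A) (\<lambda>x. lact A (xs[i := x] ! 0) (C (drop 1 (xs[i := x]))))"
    proof (cases i)
      case 0
      then show ?thesis
        using l lin_on_comp[OF graded_bilinearD(2)[OF lact_bilinear] lin_id] by simp
    next
      case (Suc i')
      then have "lin_on (vscale A) UNIV (mscale A) (\<lambda>x. C ((drop 1 xs)[i' := x]))"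
        using l by (intro multilinear_onD[OF ml]) auto
      then show ?thesis
        using l Suc lin_on_comp[OF graded_bilinearD(1)[OF lact_bilinear]] by (simp add: drop_update_swap)
    qed
  qed
  have 3: "multilinear_on (vscale A) UNIV (mscale A) (Suc k)
      (\<lambda>xs. C (take j xs @ vmul A (xs ! j) (xs ! Suc j) # drop (j + 2) xs))" if j: "j < k" for j
    unfolding multilinear_on_iff
  proof (intro allI impI, elim conjE)
    fix xs :: "'v list" and i assume l: "length xs = Suc k" "i < Suc k"
    let ?ys = "take j xs @ vmul A (xs ! j) (xs ! Suc j) # drop (j + 2) xs"
    have slot: "lin_on (vscale A) UNIV (mscale A) (\<lambda>x. C (?ys[i' := x]))" if "i' < k" for i'
      using l j that by (intro multilinear_onD[OF ml]) auto
    have mid: "?ys[j := x] = take j xs @ x # drop (j + 2) xs" for x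
      using l j by (simp add: list_update_append)
    \<comment> \<open>Slots j and j + 1 are the two factors of the product and both land in slot j
      of the shortened word; later slots move down by one.\<close>
    consider "i < j" | "i = j" | "i = Suc j" | "Suc j < i" by linarith
    then show "lin_on (vscale A) UNIV (mscale A)
        (\<lambda>x. C (take j (xs[i := x]) @ vmul A (xs[i := x] ! j) (xs[i := x] ! Suc j) # drop (j + 2) (xs[i := x])))"
    proof cases
      case 1
      then show ?thesis using slot[of i] l j by (simp add: take_update_swap list_update_append)
    next
      case 2
      then show ?thesis
        using slot[of j] l j linear_plus[OF graded_bilinearD(2)[OF vmul_bilinear]]
          linear_scale'[OF graded_bilinearD(2)[OF vmul_bilinear]]
        unfolding mid by (simp add: lin_on_def)
    next
      case 3
      then show ?thesis
        using slot[of j] l j linear_plus[OF graded_bilinearD(1)[OF vmul_bilinear]]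
          linear_scale'[OF graded_bilinearD(1)[OF vmul_bilinear]]
        unfolding mid by (simp add: lin_on_def)
    next
      case 4
      then obtain m where m: "i = Suc (Suc j + m)" using less_iff_Suc_add by blast
      then have "?ys[i - 1 := x] = take j xs @ vmul A (xs ! j) (xs ! Suc j) # (drop (j + 2) xs)[i - (j + 2) := x]" for x
        using l j by (simp add: list_update_append Suc_diff_le)
      then show ?thesis using slot[of "i - 1"] l j 4 by (simp add: drop_update_swap)
    qed
  qed
  show ?thesis unfolding hml_def
  proof (intro allI impI, elim conjE)
    fix ds xs i assume *: "homog (vgr A) ds xs" "length xs = Suc k" "i < Suc k"
    show "lin_on (vscale A) (vgr A (ds ! i)) (mscale A) (\<lambda>x. hoch_val k w C ds (xs[i := x]))"
      unfolding hoch_val_def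
      by (intro M.lin_on_diff M.lin_on_add M.lin_on_ksg M.lin_on_sum
          lin_on_mono[OF multilinear_onD[OF 1]] lin_on_mono[OF multilinear_onD[OF 2]]
          lin_on_mono[OF multilinear_onD[OF 3]]) (use * in auto)
  qed
qed

lemma hoch_shifted_cochain:
  assumes C: "C \<in> cochains A k p"
  shows "hoch_shifted A k (p + int k - 1) C \<in> cochains A (Suc k) p"
    and "homog (vgr A) ds xs \<Longrightarrow> length xs = Suc k
      \<Longrightarrow> hoch_shifted A k (p + int k - 1) C xs = hoch_val k (p + int k - 1) C ds xs"
proof -
  show val: "hoch_shifted A k (p + int k - 1) C xs = hoch_val k (p + int k - 1) C ds xs"
    if "homog (vgr A) ds xs" "length xs = Suc k" for ds xs
    using hoch_shifted_eq_kext[OF C that(2)] V.kext_hml[OF hoch_val_hml[OF C] that] by simp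
  have "multilinear_on (vscale A) UNIV (mscale A) (Suc k) (hoch_shifted A k (p + int k - 1) C)"
    by (rule multilinear_on_cong[OF hoch_shifted_eq_kext[OF C]])
      (auto intro: V.kext_multilinear M.vector_space_axioms hoch_val_hml[OF C])
  moreover have "hoch_shifted A k (p + int k - 1) C xs \<in> mgr A (sum_list ds + p)"
    if "homog (vgr A) ds xs" "length xs = Suc k" for ds xs
    unfolding val[OF that] by (rule hoch_val_in[OF C that])
  ultimately show "hoch_shifted A k (p + int k - 1) C \<in> cochains A (Suc k) p"
    by (simp add: cochains_iff)
qed

lemma hochschild_d_cochain:
  assumes "c \<in> cochains A k p"
  shows "hochschild_d A k p c \<in> cochains A (Suc k) p"
  unfolding hochschild_d_def by (intro cochain_shift hoch_shifted_cochain assms)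

text \<open>\<open>hochschild_d\<close> is obtained by removing the shift from [Q, C]; shifting once
  more restores it.\<close>

lemma shift_hochschild_d:
  assumes "c \<in> cochains A k p" "homog (vgr A) ds xs" "length xs = Suc k"
  shows "shift (vgr A) (Suc k) (hochschild_d A k p c) xs
    = hoch_val k (p + int k - 1) (shift (vgr A) k c) ds xs"
  using V.shift_shift[OF M.vector_space_axioms
      cochain_multilinear[OF hoch_shifted_cochain(1)[OF cochain_shift[OF assms(1)]]] assms(3)]
    hoch_shifted_cochain(2)[OF cochain_shift[OF assms(1)] assms(2,3)]
  by (simp add: hochschild_d_def)

text \<open>The two parts of the \<open>M\<^sup>\<star>\<close>-component of the last letter of \<open>insertQ k us\<close>.\<close>

definition corner_left :: "nat \<Rightarrow> ('v list \<Rightarrow> 'm) \<Rightarrow> int list \<Rightarrow> ('k, 'v, 'm) tilde list \<Rightarrow> 'k" where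
  "corner_left k C ds us = - ksg (ds ! k - 1)
     (dual_lact (mgr A) (ract A) (ds ! k) (ds ! Suc k) (vpart (us ! k)) (mdual (us ! Suc k)) (C (map fst (take k us))))"

definition corner_right :: "nat \<Rightarrow> ('v list \<Rightarrow> 'm) \<Rightarrow> int list \<Rightarrow> ('k, 'v, 'm) tilde list \<Rightarrow> 'k" where
  "corner_right k C ds us = - ksg (ds ! k - 1)
     (mdual (us ! k) (lact A (vpart (us ! Suc k)) (C (map fst (take k us)))))"

lemma corner_insertQ_last:
  assumes "homog (tgr A) ds us" "length us = k + 2"
  shows "corner C (insertQ k us) = corner_left k C ds us + corner_right k C ds us"
proof -
  have "us ! k \<in> tgr A (ds ! k)" "us ! Suc k \<in> tgr A (ds ! Suc k)"
    using assms by (auto intro: homog_nth)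
  then show ?thesis
    using assms(2)
    by (simp add: insertQ_def corner_snoc tQ_homog tprod_def dual_ract_def corner_left_def corner_right_def
        ksg_fun ksg_add)
qed

lemma corner_insertQ:
  assumes C: "C \<in> cochains A k p" and h: "homog (tgr A) ds (us @ [u])" "length us = Suc k" and j: "j < k"
  shows "corner C (insertQ j (us @ [u])) = - ksg (ds ! j - 1) (mdual u
    (C (take j (map fst us) @ vmul A (map fst us ! j) (map fst us ! Suc j) # drop (j + 2) (map fst us))))"
proof -
  have u: "us ! j \<in> tgr A (ds ! j)" "us ! Suc j \<in> tgr A (ds ! Suc j)"
    using homog_nth[OF h(1), of j] homog_nth[OF h(1), of "Suc j"] h(2) j by (auto simp: nth_append)
  obtain d where "u \<in> tgr A d" using homog_nth[OF h(1), of "Suc k"] h(2) by (auto simp: nth_append)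
  then have lin: "Vector_Spaces.linear (mscale A) (*) (mdual u)" by (rule dual_gr_linear[OF tgrD(4)])
  have "insertQ j (us @ [u]) = (take j us @ tQ A [us ! j, us ! Suc j] # drop (j + 2) us) @ [u]"
    using h(2) j by (simp add: insertQ_def nth_append)
  then have "corner C (insertQ j (us @ [u])) = - mdual u
      (C (take j (map fst us) @ ksg (ds ! j - 1) (vmul A (map fst us ! j) (map fst us ! Suc j)) # drop (j + 2) (map fst us)))"
    using h(2) j by (simp only: corner_snoc)
      (simp add: tQ_homog[OF u] tprod_def take_map drop_map)
  also have "\<dots> = - ksg (ds ! j - 1) (mdual u
    (C (take j (map fst us) @ vmul A (map fst us ! j) (map fst us ! Suc j) # drop (j + 2) (map fst us))))"
    using h(2) j by (subst cochain_ksg_slot[OF cochain_multilinear[OF C]]) (auto simp: linear_ksg[OF lin])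
  finally show ?thesis .
qed

text \<open>The dual left action of x on h evaluates h at C(...) x, so this half of the product
  yields the right action on M. Total degree zero makes the exponent of \<open>dual_lact\<close>
  equal to -(ds ! k)^2, of the parity of \<open>ds ! k\<close>. With the shift exponent
  \<open>ds ! k - 1\<close> this is odd, so \<open>corner_left\<close> is plus the evaluation;
  \<open>par\<close> gives the right-hand side the same sign.\<close>

lemma corner_left_eq:
  assumes C: "C \<in> cochains A k p" and h: "homog (tgr A) ds (us @ [u])" "length us = Suc k"
    and deg: "sum_list ds + p = 0" and par: "even (p + int k)"
  shows "ksg (sdeg (take k ds)) (corner_left k C ds (us @ [u]))
    = - ksg (p + int k - 1 + sdeg (take k ds)) (mdual u (ract A (C (take k (map fst us))) (map fst us ! k)))"
proof -
  have l: "length ds = k + 2" using list_all2_lengthD[OF h(1)] h(2) by simp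
  let ?a = "sum_list (take k ds) + p"
  have u: "mdual u \<in> dual_gr (mscale A) (mgr A) (ds ! Suc k)"
    using tgrD(4)[OF homog_nth[OF h(1), of "Suc k"]] h(2) by (simp add: nth_append)
  have "homog (vgr A) (take k ds) (map fst (take k (us @ [u])))"
    by (intro homog_fst homog_take h)
  then have a: "C (map fst (take k us)) \<in> mgr A ?a"
    using cochain_in[OF C, of "take k ds" "map fst (take k us)"] h(2) by simp
  obtain es' d' where "ds = es' @ [d']" "length es' = Suc k"
    using l by (auto simp: length_Suc_conv_rev)
  moreover from this(2) obtain es d where "es' = es @ [d]" "length es = k"
    by (auto simp: length_Suc_conv_rev)
  ultimately have "sum_list ds = sum_list (take k ds) + ds ! k + ds ! Suc k"
    by (simp add: nth_append)
  then have d: "ds ! Suc k = - ?a - ds ! k" using deg by simp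
  have s: "sdeg (take k ds) = ?a - p - int k" using l by (simp add: sdeg_eq)
  show ?thesis
    unfolding corner_left_def using h(2)
    by (simp add: dual_lact_homog[OF M.finite_graded_axioms ract_bilinear dual_gr_linear[OF u] a]
        nth_append ksg_minus take_map)
      (rule ksg_cong, use par in \<open>auto simp: s d\<close>)
qed

text \<open>One rotation turns x_1, ..., x_{k+1}, h into x_2, ..., x_{k+1}, h, x_1. The half h . x_1
  of the last product then evaluates h at x_1 C(x_2, ..., x_{k+1}), the left action term. The prefix
  sign and the shift sign combine to the parity of the total shifted degree, which is even.\<close>

lemma corner_right_eq:
  assumes h: "length ds = k + 2" "length us = Suc k"
    and deg: "even (sdeg ds)"
  shows "ksg (ds ! 0 - 1 + sdeg (take k (rotate1 ds))) (corner_right k C (rotate1 ds) (rotate1 (us @ [u])))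
    = - mdual u (lact A (map fst us ! 0) (C (drop 1 (map fst us))))"
proof -
  obtain es e where "ds = es @ [e]" "length es = Suc k"
    using h(1) by (auto simp: length_Suc_conv_rev)
  then obtain d ms where ds: "ds = d # ms @ [e]" "length ms = k"
    by (auto simp: length_Suc_conv)
  obtain v ws where us: "us = v # ws" "length ws = k" using h(2) by (auto simp: length_Suc_conv)
  have r: "corner_right k C (rotate1 ds) (rotate1 (us @ [u])) = - ksg (e - 1) (mdual u (lact A (fst v) (C (map fst ws))))"
    using ds us by (simp add: corner_right_def nth_append)
  have "even (d - 1 + sdeg ms + (e - 1))" using deg ds by simp
  then have "ksg (d - 1 + sdeg ms + (e - 1)) x = x" for x :: 'k by (simp add: ksg_def del: even_add even_diff)
  then show ?thesis unfolding r using ds us by (simp add: ksg_minus)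
qed

text \<open>Rewrites a single unrotated corner of [Q, C] through contractions of the word. Each
  exponent is the sum of the shifted degrees in front of the contracted pair along the cyclic word,
  which is what makes the later reindexing compatible with signs.\<close>

lemma corner_hochschild_d:
  assumes c: "c \<in> cochains A k (2 - int k)" and h: "homog (tgr A) ds us" "length us = k + 2"
    and deg: "sum_list ds + (2 - int k) = 0"
  defines "C \<equiv> shift (vgr A) k c"
  shows "corner (shift (vgr A) (Suc k) (hochschild_d A k (2 - int k) c)) us
    = ksg (sdeg (take k ds)) (corner_left k C ds us)
      + ksg (ds ! 0 - 1 + sdeg (take k (rotate1 ds))) (corner_right k C (rotate1 ds) (rotate1 us))
      + (\<Sum>j<k. ksg (sdeg (take j ds)) (corner C (insertQ j us)))"
proof -
  have C: "C \<in> cochains A k (2 - int k)" unfolding C_def by (rule cochain_shift[OF c])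
  obtain ws u where us: "us = ws @ [u]" "length ws = Suc k" using h(2) by (auto simp: length_Suc_conv_rev)
  have l: "length ds = k + 2" using list_all2_lengthD[OF h(1)] h(2) by simp
  then obtain es e where ds: "ds = es @ [e]" "length es = Suc k" by (auto simp: length_Suc_conv_rev)
  note h' = h(1)[unfolded us(1)]
  have hw: "homog (vgr A) es (map fst ws)" and u: "u \<in> tgr A e"
    using h' ds by (auto simp: homog_snoc intro: homog_fst)
  have lin: "Vector_Spaces.linear (mscale A) (*) (mdual u)" by (rule dual_gr_linear[OF tgrD(4)[OF u]])
  have lin_diff: "mdual u (a - b) = mdual u a - mdual u b" for a b
    using lin by (simp add: linear_iff_module_hom module_hom.diff)
  have "sdeg ds = - 4" using l deg by (simp add: sdeg_eq)
  then have ev: "even (sdeg ds)" by simp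
  \<comment> \<open>The shifted degree of \<open>C\<close> is 1, so the exponent of the left action
    term in \<open>hoch_val\<close> is a multiple of 2.\<close>
  have w: "2 - int k + int k - 1 = 1" by simp
  have "corner (shift (vgr A) (Suc k) (hochschild_d A k (2 - int k) c)) us
      = - mdual u (hoch_val k 1 C es (map fst ws))"
    using shift_hochschild_d[OF c hw] us unfolding us(1) corner_snoc C_def w by simp
  also have "\<dots> = - ksg (1 + sdeg (take k ds)) (mdual u (ract A (C (take k (map fst ws))) (map fst ws ! k)))
      - mdual u (lact A (map fst ws ! 0) (C (drop 1 (map fst ws))))
      + (\<Sum>j<k. ksg (1 + sdeg (take (Suc j) ds)) (mdual u
          (C (take j (map fst ws) @ vmul A (map fst ws ! j) (map fst ws ! Suc j) # drop (j + 2) (map fst ws)))))"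
  proof -
    have e2: "ksg ((1 + 1) * n) x = x" for n and x :: 'k by (simp add: ksg_def)
    have t: "take j ds = take j es" if "j \<le> k" for j using ds that by simp
    show ?thesis
      unfolding hoch_val_def lin_diff linear_plus[OF lin] linear_sum'[OF lin] linear_ksg[OF lin] e2
      by (simp add: t)
  qed
  also have "(\<Sum>j<k. ksg (1 + sdeg (take (Suc j) ds)) (mdual u
          (C (take j (map fst ws) @ vmul A (map fst ws ! j) (map fst ws ! Suc j) # drop (j + 2) (map fst ws)))))
      = (\<Sum>j<k. ksg (sdeg (take j ds)) (corner C (insertQ j us)))"
  proof (intro sum.cong refl)
    fix j assume "j \<in> {..<k}"
    then have j: "j < k" by simp
    have "sdeg (take (Suc j) ds) = sdeg (take j ds) + (ds ! j - 1)"
      using j l by (simp add: take_Suc_conv_app_nth)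
    then show "ksg (1 + sdeg (take (Suc j) ds)) (mdual u
          (C (take j (map fst ws) @ vmul A (map fst ws ! j) (map fst ws ! Suc j) # drop (j + 2) (map fst ws))))
        = ksg (sdeg (take j ds)) (corner C (insertQ j us))"
      unfolding us(1) corner_insertQ[OF C h' us(2) j] ksg_minus ksg_ksg
      by (intro ksg_minus_cong) simp
  qed
  finally show ?thesis
    using corner_left_eq[OF C h' us(2) deg] corner_right_eq[OF l us(2) ev, of C u]
    unfolding us(1) w by simp
qed

section \<open>Reindexing the double cyclic sum\<close>

lemma sdeg_take_rotate:
  assumes "ds \<noteq> []" "j \<le> length ds"
  shows "sdeg (take j (rotate r ds)) = (\<Sum>i<j. ds ! ((r + i) mod length ds) - 1)"
  using assms(2)
proof (induction j)
  case (Suc j)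
  then show ?case by (simp add: take_Suc_conv_app_nth nth_rotate)
qed simp

text \<open>Both sides are sums over a cyclic place \<open>r\<close>, where \<open>tQ\<close> acts,
  and a position j <= k of its value in the word read by \<open>corner\<close>. For fixed
  \<open>r\<close> the positions j run through all rotations of the contracted word and form one
  value of \<open>Omega_of A k c\<close>. Following instead the rotations of the uncontracted word
  gives the corners of [Q, C]; periodicity allows each family of terms to be shifted
  separately.\<close>

lemma Omega_of_hochschild_d:
  assumes c: "c \<in> cochains A k (2 - int k)" and h: "homog (tgr A) ds vs" "length vs = k + 2"
  shows "(\<Sum>r<k + 2. ksg (sdeg (take r ds) * sdeg (drop r ds)) (Omega_of A k c (insertQ 0 (rotate r vs))))
    = Omega_of A (k + 1) (hochschild_d A k (2 - int k) c) vs"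
proof -
  let ?n = "k + 2"
  define C where "C = shift (vgr A) k c"
  define C' where "C' = shift (vgr A) (Suc k) (hochschild_d A k (2 - int k) c)"
  have l: "length ds = ?n" using list_all2_lengthD[OF h(1)] h(2) by simp
  note hr = homog_rotate[OF h(1)]
  \<comment> \<open>\<open>tQ\<close> preserves the sum of unshifted degrees, so the degree
    condition on a contracted word is the one on \<open>vs\<close>.\<close>
  have hQ: "\<exists>es. homog (tgr A) es (insertQ 0 (rotate r vs)) \<and> sum_list es = sum_list ds" for r
  proof -
    obtain v w rest where vs: "rotate r vs = v # w # rest"
      using h(2) by (metis (no_types, opaque_lifting) Suc_1 add_Suc_right add_2_eq_Suc' length_Suc_conv length_rotate)
    obtain d1 d2 es where ds: "rotate r ds = d1 # d2 # es" and v: "v \<in> tgr A d1" and w: "w \<in> tgr A d2"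
      and rest: "homog (tgr A) es rest"
      using hr[of r] by (auto simp: vs list_all2_Cons2)
    have "homog (tgr A) ((d1 + d2) # es) (insertQ 0 (rotate r vs))"
      using rest tQ_in[OF v w] by (simp add: vs insertQ_def)
    moreover have "sum_list ((d1 + d2) # es) = sum_list ds"
      using sum_list_rotate[of r ds] ds by (simp add: add_ac)
    ultimately show ?thesis by blast
  qed
  have lQ: "length (insertQ 0 (rotate r vs)) = Suc k" for r using h(2) by (simp add: insertQ_def)
  have LHS: "Omega_of A k c (insertQ 0 (rotate r vs)) = (\<Sum>s<Suc k. corner C (rotate s (insertQ 0 (rotate r vs))))" for r
    using hQ[of r] Omega_of_odd[OF c _ lQ] unfolding C_def by blast
  have RHS: "Omega_of A (k + 1) (hochschild_d A k (2 - int k) c) vs = rot_sum C' ds vs"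
    using Omega_of_homog[OF hochschild_d_cochain[OF c] h(1)] h(2) by (simp add: C'_def)
  show ?thesis
  proof (cases "sum_list ds + (2 - int k) = 0")
    case False
    have "Omega_of A k c (insertQ 0 (rotate r vs)) = 0" for r
      using hQ[of r] Omega_of_vanish[OF c _ lQ] False by metis
    moreover have "Omega_of A (k + 1) (hochschild_d A k (2 - int k) c) vs = 0"
      using Omega_of_vanish[OF hochschild_d_cochain[OF c] h(1)] h(2) False by simp
    ultimately show ?thesis by simp
  next
    case True
    have S: "sdeg ds = - 4" using l True by (simp add: sdeg_eq)
    \<comment> \<open>Prefix sums of the shifted degrees, continued around the circle. One full turn
      adds -4, so the parity has period k + 2.\<close>
    define P where "P r = (\<Sum>i<r. ds ! (i mod ?n) - 1)" for r
    have P_add: "P (r + j) = P r + sdeg (take j (rotate r ds))" if "j \<le> ?n" for r j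
    proof -
      have "P (r + j) = P r + (\<Sum>i<j. ds ! ((r + i) mod ?n) - 1)"
        unfolding P_def by (induction j) (simp_all add: add.assoc)
      then show ?thesis using sdeg_take_rotate[of ds j r] that l by force
    qed
    have P_per: "ksg (P (r + ?n)) x = ksg (P r) x" for r and x :: 'k
    proof (rule ksg_cong)
      have "sdeg (rotate r ds) = - 4" using S by (simp add: sdeg_eq sum_list_rotate)
      then have "P (r + ?n) = P r - 4" using P_add[of ?n r] l by simp
      then show "even (P (r + ?n) + P r)" by simp
    qed
    \<comment> \<open>As the total is even, both arcs have the parity of \<open>P r\<close>, and so
      does their product.\<close>
    have sign: "ksg (sdeg (take r ds) * sdeg (drop r ds)) x = ksg (P r) x" if "r < ?n" for r and x :: 'k
    proof (rule ksg_cong)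
      have "P r = sdeg (take r ds)" using P_add[of r 0] that by (simp add: P_def)
      moreover have "sdeg (take r ds) + sdeg (drop r ds) = - 4"
        using S sdeg_append[of "take r ds" "drop r ds"] by simp
      then have "sdeg (drop r ds) = - 4 - sdeg (take r ds)" by simp
      ultimately show "even (sdeg (take r ds) * sdeg (drop r ds) + P r)" by simp
    qed
    \<comment> \<open>The two halves of the product at the end of the word; in the word rotated by
      \<open>r\<close> this pair starts at cyclic place r + k, whence the sign.\<close>
    define f where "f r = ksg (P (r + k)) (corner_left k C (rotate r ds) (rotate r vs))" for r
    define g where "g r = ksg (P (r + k)) (corner_right k C (rotate r ds) (rotate r vs))" for r
    \<comment> \<open>Here \<open>r\<close> is the cyclic place of the contracted pair and
      \<open>j\<close> the position its value takes in the word; the sign depends on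
      \<open>r\<close> only.\<close>
    define q where "q j r = ksg (P r) (corner C (rotate (k + 1 - j) (insertQ 0 (rotate r vs))))" for j r
    have per: "rotate (r + ?n) vs = rotate r vs" "rotate (r + ?n) ds = rotate r ds" for r
      using rotate_add_length[of r vs] rotate_add_length[of r ds] h(2) l by simp_all
    have g_per: "g (r + ?n) = g r" for r
      using P_per[of "r + k"] unfolding g_def per by (simp add: add_ac)
    have q_per: "q j (r + ?n) = q j r" for j r
      unfolding q_def per P_per ..
    have q_insertQ: "q j (r + j) = ksg (P (r + j)) (corner C (insertQ j (rotate r vs)))" if "j \<le> k" for j r
      using insertQ_rotate[of "rotate r vs" k j] h(2) that
      by (simp add: q_def rotate_rotate add.commute)
    \<comment> \<open>The left action term lives on the word rotated by one more step, hence
      \<open>g (Suc r)\<close> next to \<open>f r\<close>. Summing over a period brings the two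
      halves back to the same rotation.\<close>
    have summand: "ksg (P r) (corner C' (rotate r vs)) = f r + g (Suc r) + (\<Sum>j<k. q j (r + j))" for r
    proof -
      have "ksg (P r) (corner C' (rotate r vs)) = ksg (P r + sdeg (take k (rotate r ds))) (corner_left k C (rotate r ds) (rotate r vs))
        + ksg (P r + (rotate r ds ! 0 - 1 + sdeg (take k (rotate (Suc r) ds)))) (corner_right k C (rotate (Suc r) ds) (rotate (Suc r) vs))
        + (\<Sum>j<k. ksg (P r + sdeg (take j (rotate r ds))) (corner C (insertQ j (rotate r vs))))"
        unfolding C'_def C_def using h(2) True
        by (subst corner_hochschild_d[OF c hr]) (simp_all add: sum_list_rotate ksg_add ksg_sum)
      moreover have "P r + (rotate r ds ! 0 - 1 + sdeg (take k (rotate (Suc r) ds))) = P (Suc r + k)"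
      proof -
        have "sdeg (take 1 (rotate r ds)) = rotate r ds ! 0 - 1"
          using l by (cases "rotate r ds") auto
        then show ?thesis using P_add[of k "Suc r"] P_add[of 1 r] by simp
      qed
      moreover have "P r + sdeg (take j (rotate r ds)) = P (r + j)" if "j \<le> k" for j
        using P_add[of j r] that by simp
      ultimately show ?thesis unfolding f_def g_def using q_insertQ by simp
    qed
    \<comment> \<open>The missing position j = k: there both halves of the product contribute at
      once.\<close>
    have fg: "f r + g r = q k (r + k)" for r
      using q_insertQ[of k r] corner_insertQ_last[OF hr[of r], of k C] h(2)
      by (simp add: f_def g_def ksg_add)
    have "rot_sum C' ds vs = (\<Sum>r<?n. f r + g (Suc r) + (\<Sum>j<k. q j (r + j)))"
      unfolding rot_sum_def h(2) by (intro sum.cong refl) (simp add: sign summand)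
    also have "\<dots> = (\<Sum>r<?n. f r) + (\<Sum>r<?n. g (r + 1)) + (\<Sum>r<?n. \<Sum>j<k. q j (r + j))"
      by (simp only: sum.distrib Suc_eq_plus1)
    also have "(\<Sum>r<?n. g (r + 1)) = (\<Sum>r<?n. g r)"
      by (rule sum_periodic_shift[of g ?n 1, OF g_per])
    also have "(\<Sum>r<?n. f r) + (\<Sum>r<?n. g r) = (\<Sum>r<?n. q k (r + k))"
      by (simp only: fg sum.distrib[symmetric])
    also have "(\<Sum>r<?n. q k (r + k)) + (\<Sum>r<?n. \<Sum>j<k. q j (r + j)) = (\<Sum>r<?n. \<Sum>j<Suc k. q j (r + j))"
      by (simp only: sum.lessThan_Suc[of _ k] sum.distrib add.commute)
    also have "\<dots> = (\<Sum>j<Suc k. \<Sum>r<?n. q j (r + j))" by (rule sum.swap)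
    also have "\<dots> = (\<Sum>j<Suc k. \<Sum>r<?n. q j r)"
      by (intro sum.cong refl sum_periodic_shift[of "q _" ?n, OF q_per])
    also have "\<dots> = (\<Sum>r<?n. \<Sum>j<Suc k. q j r)" by (rule sum.swap)
    also have "\<dots> = (\<Sum>r<?n. ksg (P r) (Omega_of A k c (insertQ 0 (rotate r vs))))"
    proof (intro sum.cong refl)
      fix r
      let ?x = "\<lambda>s. corner C (rotate s (insertQ 0 (rotate r vs)))"
      \<comment> \<open>For j = 0, ..., k the rotation count k + 1 - j runs from k + 1 down to 1, so
        the full turn takes the place of the trivial rotation.\<close>
      have x: "?x (Suc k) = ?x 0" using lQ[of r] rotate_add_length[of 0 "insertQ 0 (rotate r vs)"] by simp
      have "(\<Sum>j<Suc k. ?x (k + 1 - j)) = (\<Sum>j<Suc k. ?x (Suc j))"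
        using sum.nat_diff_reindex[of "\<lambda>j. ?x (Suc j)" "Suc k"] by (simp add: Suc_diff_le)
      also have "\<dots> = (\<Sum>j<Suc k. ?x j)"
        using sum.lessThan_Suc_shift[of ?x k] x by (simp only: sum.lessThan_Suc[of _ k] add.commute)
      finally show "(\<Sum>j<Suc k. q j r) = ksg (P r) (Omega_of A k c (insertQ 0 (rotate r vs)))"
        by (simp only: LHS q_def ksg_sum[symmetric])
    qed
    also have "\<dots> = (\<Sum>r<?n. ksg (sdeg (take r ds) * sdeg (drop r ds)) (Omega_of A k c (insertQ 0 (rotate r vs))))"
      by (intro sum.cong refl) (simp add: sign)
    finally show ?thesis using RHS by simp
  qed
qed

end

text \<open>The constant 3 is the degree of the form: C has shifted degree (2 - k) + k - 1 = 1, and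
  B contributes 2. Identities of forms are stated on words in \<open>tcarrier A\<close>, since other
  inhabitants of the type are not elements of the double semidirect product.\<close>

theorem proposition4p3:
  fixes A :: "('k::field_char_0, 'v::ab_group_add, 'm::ab_group_add) gbimod"
    and k N :: nat
    and e e' :: "nat \<Rightarrow> ('k, 'v, 'm) tilde"
  assumes bimodule: "graded_bimodule A"
    and bases: "dual_bases A N e e'"
  shows "(\<forall>c \<in> cochains A k (2 - int k). Omega_of A k c \<in> cyclic_forms A (k + 1)) \<and>
         (\<forall>c \<in> cochains A k (2 - int k). \<forall>c' \<in> cochains A k (2 - int k). \<forall>r s.
           \<forall>vs. length vs = k + 1 \<and> set vs \<subseteq> tcarrier A \<longrightarrow>
             Omega_of A k (\<lambda>xs. mscale A r (c xs) + mscale A s (c' xs)) vs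
             = r * Omega_of A k c vs + s * Omega_of A k c' vs) \<and>
         (\<forall>c \<in> cochains A k (2 - int k).
           \<forall>vs. length vs = k + 2 \<and> set vs \<subseteq> tcarrier A \<longrightarrow>
             pinczon_d A N e e' (k + 1) 3 (Omega_of A k c) vs
             = Omega_of A (k + 1) (hochschild_d A k (2 - int k) c) vs)"
proof -
  interpret graded_bimod A by unfold_locales (rule bimodule)
  have "pinczon_d A N e e' (k + 1) 3 (Omega_of A k c) vs
      = Omega_of A (k + 1) (hochschild_d A k (2 - int k) c) vs"
    if c: "c \<in> cochains A k (2 - int k)" and vs: "length vs = k + 2" "set vs \<subseteq> tcarrier A" for c vs
    unfolding pinczon_d_eq_kext[OF bases Omega_of_multilinear[OF c] vs]
  proof (rule T.kext_multilinear_on[OF _ K.vector_space_axioms vs])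
    show "multilinear_on (tscale A) (tcarrier A) (*) (k + 2) (Omega_of A (k + 1) (hochschild_d A k (2 - int k) c))"
      using Omega_of_multilinear[OF hochschild_d_cochain[OF c]] by simp
  qed (rule Omega_of_hochschild_d[OF c])
  then show ?thesis
    using Omega_of_cyclic Omega_of_lin_comb by simp
qed

end
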